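(* Let $X\subset\mathbb P^{a_1}\times\mathbb P^{a_2}$ be a finite set of points with the inclusion property with respect to $\pi_1$. Then $X$ is arithmetically Cohen-Macaulay.
   Context: We work over a field $k$ of characteristic zero. Let $R=k[x_0,\dots,x_{a_1},y_0,\dots,y_{a_2}]$ be the bigraded coordinate ring of $\mathbb P^{a_1}\times\mathbb P^{a_2}$, with $\deg x_i=(1,0)$ and $\deg y_j=(0,1)$. For a finite set of points $X$, $I_X\subset R$ is the ideal generated by all bihomogeneous polynomials vanishing at every point of $X$, and $X$ is arithmetically Cohen-Macaulay (ACM) if $R/I_X$ is a Cohen-Macaulay ring; ACM for finite sets in $\mathbb P^{a_2}$ is defined in the same way (and always holds there). Let $\eta_1:\mathbb P^{a_1}\times\mathbb P^{a_2}\to\mathbb P^{a_1}$ be the projection to the first factor and $\pi_1:\mathbb P^{a_1}\times\mathbb P^{a_2}\to\mathbb P^{a_2}$ the projection omitting the first factor. Write $\eta_1(X)=\{P_1,\dots,P_t\}$ and let $X_j=\eta_1^{-1}(P_j)\cap X$ (the level sets of $X$). $X$ has the inclusion property with respect to $\pi_1$ if the collection of subsets $\{\pi_1(X_1),\dots,\pi_1(X_t)\}$ of $\mathbb P^{a_2}$ is totally ordered by inclusion and all its members are ACM. *)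

theory Defs
  imports
    "HOL-Library.Poly_Mapping"
    "HOL-Library.Extended_Nat"
    "HOL-Algebra.Algebra"
    "HOL-Algebra.Algebraic_Closure_Type"
begin

section \<open>Cohen-Macaulay rings\<close>

text \<open>The last condition says that \<open>xs ! i\<close> is a nonzerodivisor on the
  quotient of \<open>A\<close> by the ideal generated by the preceding elements.\<close>

definition regular_sequence :: "('a, 'b) ring_scheme \<Rightarrow> 'a list \<Rightarrow> bool" where
  "regular_sequence A xs \<longleftrightarrow>
     set xs \<subseteq> carrier A \<and> Idl\<^bsub>A\<^esub> (set xs) \<noteq> carrier A \<and>
     (\<forall>i < length xs. \<forall>y \<in> carrier A.
        xs ! i \<otimes>\<^bsub>A\<^esub> y \<in> Idl\<^bsub>A\<^esub> (set (take i xs)) \<longrightarrow> y \<in> Idl\<^bsub>A\<^esub> (set (take i xs)))"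

definition ideal_depth :: "('a, 'b) ring_scheme \<Rightarrow> 'a set \<Rightarrow> enat" where
  "ideal_depth A I = Sup {enat (length xs) |xs. regular_sequence A xs \<and> set xs \<subseteq> I}"

text \<open>The codimension (height) of a prime \<open>P\<close>: the supremum of the lengths \<open>n\<close> of strict chains
  \<open>P\<^sub>0 \<subset> \<dots> \<subset> P\<^sub>n = P\<close> of prime ideals, that is, the Krull dimension of the localization at \<open>P\<close>.\<close>

definition prime_codim :: "('a, 'b) ring_scheme \<Rightarrow> 'a set \<Rightarrow> enat" where
  "prime_codim A P =
     Sup {enat n |n. \<exists>Ps. length Ps = Suc n \<and> sorted_wrt (\<subset>) Ps \<and>
                         (\<forall>Q \<in> set Ps. primeideal Q A) \<and> last Ps = P}"

text \<open>This is the definition in Eisenbud, \<^emph>\<open>Commutative Algebra with a View Toward Algebraic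
  Geometry\<close>, Section 18.2: a Noetherian ring whose maximal ideals all have depth equal to their
  codimension. The zero ring is Cohen-Macaulay under this convention.\<close>

definition cohen_macaulay :: "('a, 'b) ring_scheme \<Rightarrow> bool" where
  "cohen_macaulay A \<longleftrightarrow>
     cring A \<and> noetherian_ring A \<and>
     (\<forall>P. maximalideal P A \<longrightarrow> ideal_depth A P = prime_codim A P)"

section \<open>Polynomials\<close>

text \<open>Polynomials over \<open>'k\<close> with variables indexed by \<open>'v\<close>, as finitely supported maps from monomials
  (exponent vectors) to coefficients; multiplication is convolution.\<close>

type_synonym ('v, 'k) mpoly = "('v \<Rightarrow>\<^sub>0 nat) \<Rightarrow>\<^sub>0 'k"

definition mpoly_eval :: "('v \<Rightarrow> 'k::comm_ring_1) \<Rightarrow> ('v, 'k) mpoly \<Rightarrow> 'k" where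
  "mpoly_eval v f =
     (\<Sum>m \<in> Poly_Mapping.keys f.
        Poly_Mapping.lookup f m * (\<Prod>i \<in> Poly_Mapping.keys m. v i ^ Poly_Mapping.lookup m i))"

definition homogeneous :: "nat \<Rightarrow> ('v::finite, 'k::zero) mpoly \<Rightarrow> bool" where
  "homogeneous d f \<longleftrightarrow>
     (\<forall>m \<in> Poly_Mapping.keys f. (\<Sum>i \<in> UNIV. Poly_Mapping.lookup m i) = d)"

text \<open>The variables \<open>x\<close> of degree \<open>(1,0)\<close> are indexed by \<open>Inl\<close> and the variables \<open>y\<close> of degree
  \<open>(0,1)\<close> by \<open>Inr\<close>.\<close>

definition bihomogeneous :: "nat \<Rightarrow> nat \<Rightarrow> ('m::finite + 'n::finite, 'k::zero) mpoly \<Rightarrow> bool" where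
  "bihomogeneous d e f \<longleftrightarrow>
     (\<forall>m \<in> Poly_Mapping.keys f.
        (\<Sum>i \<in> UNIV. Poly_Mapping.lookup m (Inl i)) = d \<and>
        (\<Sum>j \<in> UNIV. Poly_Mapping.lookup m (Inr j)) = e)"

section \<open>Points in projective and biprojective space\<close>

text \<open>A point of the projective space of dimension \<open>CARD('v) - 1\<close> is the set of all its vectors of
  homogeneous coordinates, i.e. of the nonzero multiples of a nonzero vector.\<close>

definition proj_space :: "('v::finite \<Rightarrow> 'k::field) set set" where
  "proj_space = {{(\<lambda>i. c * v i) |c. c \<noteq> 0} |v. v \<noteq> (\<lambda>_. 0)}"

definition proj_ideal :: "('n::finite \<Rightarrow> 'k::field) set set \<Rightarrow> ('n, 'k) mpoly set" where
  "proj_ideal Y =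
     Idl\<^bsub>ring_of_type_algebra\<^esub>
       {f. (\<exists>d. homogeneous d f) \<and> (\<forall>Q \<in> Y. \<forall>w \<in> Q. mpoly_eval w f = 0)}"

definition proj_ACM :: "('n::finite \<Rightarrow> 'k::field) set set \<Rightarrow> bool" where
  "proj_ACM Y \<longleftrightarrow>
     cohen_macaulay ((ring_of_type_algebra :: ('n, 'k) mpoly ring) Quot proj_ideal Y)"

definition biproj_ideal ::
  "(('m::finite \<Rightarrow> 'k::field) set \<times> ('n::finite \<Rightarrow> 'k) set) set \<Rightarrow> ('m + 'n, 'k) mpoly set" where
  "biproj_ideal Z =
     Idl\<^bsub>ring_of_type_algebra\<^esub>
       {f. (\<exists>d e. bihomogeneous d e f) \<and>
           (\<forall>(P, Q) \<in> Z. \<forall>v \<in> P. \<forall>w \<in> Q. mpoly_eval (case_sum v w) f = 0)}"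

definition biproj_ACM ::
  "(('m::finite \<Rightarrow> 'k::field) set \<times> ('n::finite \<Rightarrow> 'k) set) set \<Rightarrow> bool" where
  "biproj_ACM Z \<longleftrightarrow>
     cohen_macaulay ((ring_of_type_algebra :: ('m + 'n, 'k) mpoly ring) Quot biproj_ideal Z)"

text \<open>The projection to the first factor is \<^const>\<open>fst\<close>, and the one omitting the first factor is
  \<^const>\<open>snd\<close>.\<close>

definition level_sets :: "('p \<times> 'q) set \<Rightarrow> ('p \<times> 'q) set set" where
  "level_sets Z = {fst -` {P} \<inter> Z |P. P \<in> fst ` Z}"

definition inclusion_property ::
  "(('m::finite \<Rightarrow> 'k::field) set \<times> ('n::finite \<Rightarrow> 'k) set) set \<Rightarrow> bool" where
  "inclusion_property Z \<longleftrightarrow>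
     chain_subset ((\<lambda>L. snd ` L) ` level_sets Z) \<and>
     (\<forall>Y \<in> (\<lambda>L. snd ` L) ` level_sets Z. proj_ACM Y)"

end

theory Submission
  imports Defs "HOL-Computational_Algebra.Polynomial"
begin

text \<open>Since \<open>k\<close> is infinite, the ideal of \<open>X\<close> consists of the polynomials vanishing on the planes
  \<open>{(s v, t w)}\<close>, one for each point \<open>(v, w)\<close> of \<open>X\<close>, so the coordinate ring \<open>A\<close> embeds into a finite
  product of copies of \<open>k[s, t]\<close>. Every maximal ideal of \<open>A\<close> has depth and codimension \<open>2\<close>.

  Upper bounds: by counting coefficients, any three elements of \<open>A\<close> satisfy a nontrivial polynomial
  relation, and reading off lowest coefficients rules out both regular sequences and prime
  chains of length \<open>3\<close>.

  Lower bounds: a maximal ideal contains the ideal of one of the planes, hence (Zariski's lemma in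
  \<open>k[s, t]\<close>) a polynomial \<open>p(x)\<close> and a polynomial \<open>q(y)\<close> that vanish identically on none of the
  lines through the projections of \<open>X\<close>. Then \<open>p, q\<close> is a regular sequence: \<open>q\<close> is regular on the
  coordinate ring of each fibre, and the inclusions between the fibres filter \<open>A/(p)\<close> by pieces
  which are tensor products of a \<open>k\<close>-vector space with the coordinate ring of a fibre.\<close>

section \<open>Evaluation homomorphisms\<close>

text \<open>Depth and codimension are compared at every maximal ideal, not only at the irrelevant
  one, and \<open>k\<close> need not be algebraically closed. So the members of the regular sequence
  cannot be two fixed linear forms, nor translates of them by constants; they are built from
  irreducible polynomials \<open>r_1(s)\<close> and \<open>r_2(t)\<close> found in the given maximal
  ideal, and carried to \<open>x\<close> and \<open>y\<close> by generic linear forms.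

  What makes \<open>q\<close> regular modulo \<open>p\<close> is the order in which the fibres are
  removed. Going from large to small, each point of the next fibre also lies in all fibres already
  removed. Evaluating \<open>y\<close> at such a point therefore sends the ideal of \<open>X\<close>
  into the ideal, in \<open>k[x]\<close>, of all the removed points together with the next one; and
  a \<open>y\<close>-coefficient that vanishes on the next fibre vanishes on all later ones.

  All computations are done in the polynomial ring with ideals that contain the ideal of
  \<open>X\<close>, and are carried over to the quotient only at the end. For empty \<open>X\<close>
  the quotient is the zero ring, which has no maximal ideal.\<close>

locale type_ring_hom =
  fixes h :: "'a::comm_ring_1 \<Rightarrow> 'b::comm_ring_1"
  assumes hom_add: "h (x + y) = h x + h y"
    and hom_mult: "h (x * y) = h x * h y"
    and hom_one: "h 1 = 1"
begin

lemma hom_zero: "h 0 = 0"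
  using hom_add[of 0 0] by simp

lemma hom_uminus: "h (- x) = - h x"
  using hom_add[of x "- x"] hom_zero by (simp add: eq_neg_iff_add_eq_0 add.commute)

lemma hom_diff: "h (x - y) = h x - h y"
  using hom_add[of x "- y"] hom_uminus by simp

lemma hom_power: "h (x ^ n) = h x ^ n"
  by (induction n) (simp_all add: hom_one hom_mult)

lemma hom_sum: "h (sum f A) = (\<Sum>i\<in>A. h (f i))"
  by (induction A rule: infinite_finite_induct) (simp_all add: hom_zero hom_add)

lemma hom_prod: "h (prod f A) = (\<Prod>i\<in>A. h (f i))"
  by (induction A rule: infinite_finite_induct) (simp_all add: hom_one hom_mult)

end

section \<open>Universal property of the polynomial ring\<close>

definition mpoly_const :: "'k::comm_ring_1 \<Rightarrow> ('v, 'k) mpoly" where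
  "mpoly_const a = Poly_Mapping.single 0 a"

definition mpoly_var :: "'v \<Rightarrow> ('v, 'k::comm_ring_1) mpoly" where
  "mpoly_var i = Poly_Mapping.single (Poly_Mapping.single i 1) 1"

definition monom_eval :: "('v::finite \<Rightarrow> 'b::comm_ring_1) \<Rightarrow> ('v \<Rightarrow>\<^sub>0 nat) \<Rightarrow> 'b" where
  "monom_eval v m = (\<Prod>i\<in>UNIV. v i ^ Poly_Mapping.lookup m i)"

text \<open>Every substitution used later is an instance: evaluation at a point, restriction to a
  plane or a line, the embeddings of \<open>k[x]\<close> and \<open>k[y]\<close>, partial evaluation
  in \<open>y\<close>, and the exchange of \<open>x\<close> and \<open>y\<close>.\<close>

definition mpoly_hom ::
  "('k::comm_ring_1 \<Rightarrow> 'b::comm_ring_1) \<Rightarrow> ('v::finite \<Rightarrow> 'b) \<Rightarrow> ('v, 'k) mpoly \<Rightarrow> 'b" where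
  "mpoly_hom c v f =
     (\<Sum>m \<in> Poly_Mapping.keys f. c (Poly_Mapping.lookup f m) * monom_eval v m)"

lemma monom_eval_add: "monom_eval v (m + n) = monom_eval v m * monom_eval v n"
  by (simp add: monom_eval_def lookup_add power_add prod.distrib)

lemma monom_eval_zero [simp]: "monom_eval v 0 = 1"
  by (simp add: monom_eval_def)

lemma monom_eval_single: "monom_eval v (Poly_Mapping.single i n) = v i ^ n"
proof -
  have "monom_eval v (Poly_Mapping.single i n) = (\<Prod>j\<in>UNIV. if j = i then v j ^ n else 1)"
    unfolding monom_eval_def by (rule prod.cong) (auto simp: lookup_single when_def)
  then show ?thesis by simp
qed

lemma poly_mapping_eq_sum_single:
  "f = (\<Sum>m \<in> Poly_Mapping.keys f. Poly_Mapping.single m (Poly_Mapping.lookup f m))"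
  by (rule poly_mapping_eqI)
    (auto simp: lookup_sum lookup_single when_def in_keys_iff intro: sum.neutral)

text \<open>Constants and variables generate the ring. Through \<open>mpoly_hom_unique\<close>,
  identities between homomorphisms are then checked on these generators only, without returning to
  monomials.\<close>

lemma mpoly_induct [case_names const var add mult]:
  fixes f :: "('v::finite, 'k::comm_ring_1) mpoly"
  assumes const: "\<And>a. P (mpoly_const a)" and var: "\<And>i. P (mpoly_var i)"
    and add: "\<And>f g. P f \<Longrightarrow> P g \<Longrightarrow> P (f + g)" and mult: "\<And>f g. P f \<Longrightarrow> P g \<Longrightarrow> P (f * g)"
  shows "P f"
proof -
  have one: "P 1" using const[of 1] by (simp add: mpoly_const_def)
  have power: "P (f ^ n)" if "P f" for f n
    by (induction n) (simp_all add: one mult that)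
  have sum: "P (sum F A)" if "\<And>i. i \<in> A \<Longrightarrow> P (F i)" for F and A :: "'c set"
    using that const[of 0] by (induction A rule: infinite_finite_induct) (auto simp: mpoly_const_def add)
  have prod: "P (prod F A)" if "\<And>i. i \<in> A \<Longrightarrow> P (F i)" for F and A :: "'c set"
    using that by (induction A rule: infinite_finite_induct) (auto simp: one mult)
  have single_power: "mpoly_var i ^ n = (Poly_Mapping.single (Poly_Mapping.single i n) 1 :: ('v, 'k) mpoly)" for i n
    by (induction n) (simp_all add: mpoly_var_def mult_single flip: single_add)
  have single_prod: "(\<Prod>i\<in>A. Poly_Mapping.single (F i) 1) = (Poly_Mapping.single (sum F A) 1 :: ('v, 'k) mpoly)"
    if "finite A" for F :: "'v \<Rightarrow> 'v \<Rightarrow>\<^sub>0 nat" and A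
    using that by induction (simp_all add: mult_single)
  have "Poly_Mapping.single m a = mpoly_const a * (\<Prod>i\<in>UNIV. mpoly_var i ^ Poly_Mapping.lookup m i)" for m :: "'v \<Rightarrow>\<^sub>0 nat" and a :: 'k
  proof -
    have "m = (\<Sum>i\<in>UNIV. Poly_Mapping.single i (Poly_Mapping.lookup m i))"
      by (rule poly_mapping_eqI) (simp add: lookup_sum lookup_single when_def)
    then show ?thesis
      by (simp add: single_power single_prod mpoly_const_def mult_single)
  qed
  then have "P (Poly_Mapping.single m a)" for m a
    by (simp add: mult const prod power var)
  then have "P (\<Sum>m \<in> Poly_Mapping.keys f. Poly_Mapping.single m (Poly_Mapping.lookup f m))"
    by (intro sum)
  then show ?thesis
    using poly_mapping_eq_sum_single[of f] by simp
qed

context type_ring_hom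
begin

text \<open>Cancellation can make the support of a sum smaller than the union of the supports; with
  a common finite index set the sums for \<open>f\<close>, \<open>g\<close> and \<open>f + g\<close>
  become comparable.\<close>

lemma mpoly_hom_superset:
  assumes "finite A" "Poly_Mapping.keys f \<subseteq> A"
  shows "mpoly_hom h v f = (\<Sum>m\<in>A. h (Poly_Mapping.lookup f m) * monom_eval v m)"
  unfolding mpoly_hom_def using assms
  by (intro sum.mono_neutral_left) (auto simp: in_keys_iff hom_zero)

lemma mpoly_hom_single: "mpoly_hom h v (Poly_Mapping.single m a) = h a * monom_eval v m"
  using mpoly_hom_superset[of "{m}" "Poly_Mapping.single m a"] by simp

lemma mpoly_hom_const [simp]: "mpoly_hom h v (mpoly_const a) = h a"
  by (simp add: mpoly_const_def mpoly_hom_single)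

lemma mpoly_hom_var [simp]: "mpoly_hom h v (mpoly_var i) = v i"
  by (simp add: mpoly_var_def mpoly_hom_single hom_one monom_eval_single)

lemma mpoly_hom_add: "mpoly_hom h v (f + g) = mpoly_hom h v f + mpoly_hom h v g"
proof -
  define A where "A = Poly_Mapping.keys f \<union> Poly_Mapping.keys g"
  have A: "finite A" "Poly_Mapping.keys f \<subseteq> A" "Poly_Mapping.keys g \<subseteq> A" "Poly_Mapping.keys (f + g) \<subseteq> A"
    using keys_add[of f g] by (auto simp: A_def)
  show ?thesis
    using A by (simp add: mpoly_hom_superset[of A] lookup_add hom_add distrib_right sum.distrib)
qed

lemma mpoly_hom_sum: "mpoly_hom h v (sum F A) = (\<Sum>i\<in>A. mpoly_hom h v (F i))"
  by (induction A rule: infinite_finite_induct) (simp_all add: mpoly_hom_add, simp_all add: mpoly_hom_def)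

lemma mpoly_hom_mult: "mpoly_hom h v (f * g) = mpoly_hom h v f * mpoly_hom h v g"
proof -
  let ?s = "\<lambda>f m. Poly_Mapping.single m (Poly_Mapping.lookup f m)"
  have "f * g = (\<Sum>m \<in> Poly_Mapping.keys f. ?s f m) * (\<Sum>n \<in> Poly_Mapping.keys g. ?s g n)"
    using poly_mapping_eq_sum_single[of f] poly_mapping_eq_sum_single[of g] by simp
  also have "\<dots> = (\<Sum>m \<in> Poly_Mapping.keys f. \<Sum>n \<in> Poly_Mapping.keys g. ?s f m * ?s g n)"
    by (rule sum_product)
  finally have "mpoly_hom h v (f * g) =
      (\<Sum>m \<in> Poly_Mapping.keys f. \<Sum>n \<in> Poly_Mapping.keys g. mpoly_hom h v (?s f m * ?s g n))"
    by (simp add: mpoly_hom_sum)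
  also have "\<dots> = (\<Sum>m \<in> Poly_Mapping.keys f. \<Sum>n \<in> Poly_Mapping.keys g.
      h (Poly_Mapping.lookup f m) * monom_eval v m * (h (Poly_Mapping.lookup g n) * monom_eval v n))"
    by (simp add: mult_single mpoly_hom_single hom_mult monom_eval_add mult_ac)
  finally show ?thesis
    by (simp add: mpoly_hom_def sum_product)
qed

lemma type_ring_hom_mpoly_hom: "type_ring_hom (mpoly_hom h v)"
  by unfold_locales (auto simp: mpoly_hom_add mpoly_hom_mult hom_one mpoly_hom_single simp flip: single_one)

end

lemma type_ring_hom_id: "type_ring_hom (\<lambda>x. x)"
  by unfold_locales auto

lemma type_ring_hom_comp: "type_ring_hom f \<Longrightarrow> type_ring_hom g \<Longrightarrow> type_ring_hom (\<lambda>x. f (g x))"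
  by (simp add: type_ring_hom_def)

lemma type_ring_hom_const: "type_ring_hom (mpoly_const :: 'k::comm_ring_1 \<Rightarrow> ('v, 'k) mpoly)"
  by unfold_locales (auto simp: mpoly_const_def single_add mult_single)

lemma type_ring_hom_const_poly: "type_ring_hom (\<lambda>x::'a::comm_ring_1. [:x:])"
  by unfold_locales auto

lemma type_ring_hom_poly: "type_ring_hom (\<lambda>p. poly p (x::'a::comm_ring_1))"
  by unfold_locales auto

lemma mpoly_hom_unique:
  fixes f :: "('v::finite, 'k::comm_ring_1) mpoly"
  assumes "type_ring_hom \<phi>" "type_ring_hom \<psi>"
    "\<And>a. \<phi> (mpoly_const a) = \<psi> (mpoly_const a)" "\<And>i. \<phi> (mpoly_var i) = \<psi> (mpoly_var i)"
  shows "\<phi> f = \<psi> f"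
  by (induction f rule: mpoly_induct)
    (use assms in \<open>auto simp: type_ring_hom.hom_add type_ring_hom.hom_mult\<close>)

lemma mpoly_eval_eq_mpoly_hom: "mpoly_eval v f = mpoly_hom (\<lambda>x. x) v f"
  unfolding mpoly_eval_def mpoly_hom_def monom_eval_def
  by (intro sum.cong refl arg_cong2[where f = "(*)"] prod.mono_neutral_left) (auto simp: in_keys_iff)

lemma type_ring_hom_mpoly_eval: "type_ring_hom (mpoly_eval (v :: 'v::finite \<Rightarrow> 'k::comm_ring_1))"
proof -
  have "mpoly_eval v = mpoly_hom (\<lambda>x. x) v" by (rule ext) (rule mpoly_eval_eq_mpoly_hom)
  then show ?thesis
    using type_ring_hom.type_ring_hom_mpoly_hom[OF type_ring_hom_id] by simp
qed

lemma mpoly_eval_const [simp]: "mpoly_eval (v :: 'v::finite \<Rightarrow> _) (mpoly_const a) = a"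
  by (simp add: mpoly_eval_eq_mpoly_hom type_ring_hom.mpoly_hom_const[OF type_ring_hom_id])

lemma mpoly_eval_var [simp]: "mpoly_eval (v :: 'v::finite \<Rightarrow> _) (mpoly_var i) = v i"
  by (simp add: mpoly_eval_eq_mpoly_hom type_ring_hom.mpoly_hom_var[OF type_ring_hom_id])

section \<open>Ideals and the Hilbert basis theorem\<close>

text \<open>The whole argument runs over type-class rings with this notion;
  \<open>ideal_ring_of_type_algebra_iff\<close> links it to the ideals in which the theorem is
  stated.\<close>

definition type_ideal :: "'a::comm_ring_1 set \<Rightarrow> bool" where
  "type_ideal J \<longleftrightarrow> 0 \<in> J \<and> (\<forall>a\<in>J. \<forall>b\<in>J. a + b \<in> J) \<and> (\<forall>r. \<forall>a\<in>J. r * a \<in> J)"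

lemma type_ideal_zero: "type_ideal J \<Longrightarrow> 0 \<in> J"
  and type_ideal_add: "type_ideal J \<Longrightarrow> a \<in> J \<Longrightarrow> b \<in> J \<Longrightarrow> a + b \<in> J"
  and type_ideal_mult_left: "type_ideal J \<Longrightarrow> a \<in> J \<Longrightarrow> r * a \<in> J"
  by (auto simp: type_ideal_def)

lemma type_ideal_mult_right: "type_ideal J \<Longrightarrow> a \<in> J \<Longrightarrow> a * r \<in> J"
  using type_ideal_mult_left[of J a r] by (simp add: mult.commute)

lemma type_ideal_uminus: "type_ideal J \<Longrightarrow> a \<in> J \<Longrightarrow> - a \<in> J"
  using type_ideal_mult_left[of J a "- 1"] by simp

lemma type_ideal_diff: "type_ideal J \<Longrightarrow> a \<in> J \<Longrightarrow> b \<in> J \<Longrightarrow> a - b \<in> J"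
  using type_ideal_add[of J a "- b"] type_ideal_uminus[of J b] by simp

lemma type_ideal_sum: "type_ideal J \<Longrightarrow> (\<And>i. i \<in> A \<Longrightarrow> f i \<in> J) \<Longrightarrow> sum f A \<in> J"
  by (induction A rule: infinite_finite_induct) (auto simp: type_ideal_zero type_ideal_add)

lemma type_ideal_diff_cong: "type_ideal J \<Longrightarrow> a - b \<in> J \<Longrightarrow> a \<in> J \<longleftrightarrow> b \<in> J"
  using type_ideal_add[of J "a - b" b] type_ideal_diff[of J a "a - b"] by auto

lemma type_ideal_Int: "type_ideal I \<Longrightarrow> type_ideal J \<Longrightarrow> type_ideal (I \<inter> J)"
  by (auto simp: type_ideal_def)

lemma type_ideal_image:
  assumes "type_ring_hom \<phi>" "surj \<phi>" "type_ideal K"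
  shows "type_ideal (\<phi> ` K)"
proof -
  interpret type_ring_hom \<phi> by fact
  show ?thesis
    unfolding type_ideal_def
  proof (intro conjI ballI allI)
    show "0 \<in> \<phi> ` K" using type_ideal_zero[OF assms(3)] hom_zero by force
  next
    fix a b assume "a \<in> \<phi> ` K" "b \<in> \<phi> ` K"
    then show "a + b \<in> \<phi> ` K" using type_ideal_add[OF assms(3)] by (auto simp flip: hom_add)
  next
    fix r a assume "a \<in> \<phi> ` K"
    moreover obtain s where "r = \<phi> s" using assms(2) by (meson surjD)
    ultimately show "r * a \<in> \<phi> ` K" using type_ideal_mult_left[OF assms(3)] by (auto simp flip: hom_mult)
  qed
qed

text \<open>Generation is expressed through minimality among ideals, which avoids writing out linear
  combinations of the generators.\<close>

definition finitely_generated :: "'a::comm_ring_1 set \<Rightarrow> bool" where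
  "finitely_generated J \<longleftrightarrow>
     (\<exists>G. finite G \<and> G \<subseteq> J \<and> (\<forall>I. type_ideal I \<longrightarrow> G \<subseteq> I \<longrightarrow> J \<subseteq> I))"

lemma finitely_generated_field: "type_ideal J \<Longrightarrow> finitely_generated (J :: 'k::field set)"
proof (cases "\<exists>a\<in>J. a \<noteq> 0")
  case True
  assume J: "type_ideal J"
  from True obtain a where a: "a \<in> J" "a \<noteq> 0" by blast
  have "J \<subseteq> I" if "type_ideal I" "a \<in> I" for I
  proof
    fix b
    show "b \<in> I" using type_ideal_mult_left[OF that, of "b / a"] a by simp
  qed
  then show ?thesis
    unfolding finitely_generated_def using a by (intro exI[of _ "{a}"]) auto
next
  case False
  then show ?thesis
    unfolding finitely_generated_def by (intro exI[of _ "{}"]) (auto simp: type_ideal_zero)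
qed

text \<open>Reading the coefficient at exactly \<open>n\<close> while allowing smaller degrees adds
  zero to the leading coefficients, which makes the set an ideal; multiplication by the variable
  makes it grow with \<open>n\<close>.\<close>

definition leading_coeffs :: "'a::comm_ring_1 poly set \<Rightarrow> nat \<Rightarrow> 'a set" where
  "leading_coeffs J n = {coeff p n |p. p \<in> J \<and> degree p \<le> n}"

lemma type_ideal_leading_coeffs:
  assumes "type_ideal J"
  shows "type_ideal (leading_coeffs J n)"
  unfolding type_ideal_def
proof (intro conjI ballI allI)
  show "0 \<in> leading_coeffs J n"
    unfolding leading_coeffs_def using type_ideal_zero[OF assms] by (auto intro!: exI[of _ 0])
next
  fix a b assume "a \<in> leading_coeffs J n" "b \<in> leading_coeffs J n"
  then obtain p q where "p \<in> J" "degree p \<le> n" "a = coeff p n" "q \<in> J" "degree q \<le> n" "b = coeff q n"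
    by (auto simp: leading_coeffs_def)
  then show "a + b \<in> leading_coeffs J n"
    unfolding leading_coeffs_def using type_ideal_add[OF assms]
    by (intro CollectI exI[of _ "p + q"]) (auto intro: degree_add_le)
next
  fix r a assume "a \<in> leading_coeffs J n"
  then obtain p where "p \<in> J" "degree p \<le> n" "a = coeff p n"
    by (auto simp: leading_coeffs_def)
  then show "r * a \<in> leading_coeffs J n"
    unfolding leading_coeffs_def using type_ideal_mult_left[OF assms, of p "[:r:]"] degree_smult_le[of r p]
    by (intro CollectI exI[of _ "smult r p"]) auto
qed

lemma leading_coeffs_Suc:
  assumes "type_ideal J"
  shows "leading_coeffs J n \<subseteq> leading_coeffs J (Suc n)"
proof
  fix a assume "a \<in> leading_coeffs J n"
  then obtain p where "p \<in> J" "degree p \<le> n" "a = coeff p n"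
    by (auto simp: leading_coeffs_def)
  then show "a \<in> leading_coeffs J (Suc n)"
    unfolding leading_coeffs_def using type_ideal_mult_left[OF assms, of p "[:0, 1:]"]
    by (intro CollectI exI[of _ "pCons 0 p"]) (auto simp: coeff_pCons)
qed

text \<open>The increasing ideals of leading coefficients become stationary at some
  \<open>N\<close>, because their union is finitely generated. Lifts of generators of the ideals up
  to \<open>N\<close> generate \<open>J\<close>.\<close>

lemma hilbert_basis:
  assumes noeth: "\<And>I :: 'a::comm_ring_1 set. type_ideal I \<Longrightarrow> finitely_generated I"
    and J: "type_ideal (J :: 'a poly set)"
  shows "finitely_generated J"
proof -
  define L where "L = leading_coeffs J"
  have mono: "L m \<subseteq> L n" if "m \<le> n" for m n
    using that leading_coeffs_Suc[OF J] unfolding L_def by (rule lift_Suc_mono_le[rotated])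
  have L: "type_ideal (L n)" for n
    unfolding L_def by (rule type_ideal_leading_coeffs[OF J])
  have "type_ideal (\<Union>n. L n)"
    unfolding type_ideal_def
  proof (intro conjI ballI allI)
    show "0 \<in> (\<Union>n. L n)" using type_ideal_zero[OF L] by auto
  next
    fix a b assume "a \<in> (\<Union>n. L n)" "b \<in> (\<Union>n. L n)"
    then obtain m n where "a \<in> L m" "b \<in> L n" by auto
    then have "a \<in> L (max m n)" "b \<in> L (max m n)"
      using mono[of m "max m n"] mono[of n "max m n"] by auto
    then show "a + b \<in> (\<Union>n. L n)" using type_ideal_add[OF L] by blast
  next
    fix r a assume "a \<in> (\<Union>n. L n)"
    then show "r * a \<in> (\<Union>n. L n)" using type_ideal_mult_left[OF L] by blast
  qed
  from noeth[OF this] obtain G where G: "finite G" "G \<subseteq> (\<Union>n. L n)"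
    "\<And>I. type_ideal I \<Longrightarrow> G \<subseteq> I \<Longrightarrow> (\<Union>n. L n) \<subseteq> I"
    unfolding finitely_generated_def by blast
  have "\<exists>N. G \<subseteq> L N"
    using G(1,2)
  proof (induction G)
    case (insert a G)
    then obtain N m where "G \<subseteq> L N" "a \<in> L m" by auto
    then have "insert a G \<subseteq> L (max N m)"
      using mono[of N "max N m"] mono[of m "max N m"] by auto
    then show ?case by blast
  qed auto
  then obtain N where "G \<subseteq> L N" by blast
  then have N: "L n \<subseteq> L N" for n
    using G(3)[OF L] by blast
  have "\<exists>H. finite H \<and> H \<subseteq> L n \<and> (\<forall>I. type_ideal I \<longrightarrow> H \<subseteq> I \<longrightarrow> L n \<subseteq> I)" for n
    using noeth[OF L[of n]] unfolding finitely_generated_def by simp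
  then obtain H where H: "\<And>n. finite (H n)" "\<And>n. H n \<subseteq> L n"
    "\<And>n I. type_ideal I \<Longrightarrow> H n \<subseteq> I \<Longrightarrow> L n \<subseteq> I"
    by metis
  define P where "P = (\<lambda>n a. SOME p. p \<in> J \<and> degree p \<le> n \<and> coeff p n = a)"
  have P: "P n a \<in> J \<and> degree (P n a) \<le> n \<and> coeff (P n a) n = a" if "a \<in> L n" for n a
    unfolding P_def by (rule someI_ex) (use that in \<open>auto simp: L_def leading_coeffs_def\<close>)
  define B where "B = (\<Union>n\<le>N. P n ` H n)"
  have "finite B" using H(1) by (simp add: B_def)
  moreover have "B \<subseteq> J" unfolding B_def using H(2) P by blast
  moreover have "J \<subseteq> I" if I: "type_ideal I" and BI: "B \<subseteq> I" for I
  proof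
    \<comment> \<open>Instead of combining generators explicitly, leading coefficients are compared:
      those of \<open>I \<inter> J\<close> contain those of \<open>J\<close> in every degree, so an
      element of \<open>J\<close> can be lowered in degree by subtracting one of
      \<open>I \<inter> J\<close>.\<close>
    define I' where "I' = I \<inter> J"
    have I': "type_ideal I'" unfolding I'_def by (rule type_ideal_Int[OF I J])
    have LI': "type_ideal (leading_coeffs I' n)" for n
      by (rule type_ideal_leading_coeffs[OF I'])
    have monoI': "leading_coeffs I' m \<subseteq> leading_coeffs I' n" if "m \<le> n" for m n
      using that leading_coeffs_Suc[OF I'] by (rule lift_Suc_mono_le[rotated])
    have low: "L n \<subseteq> leading_coeffs I' n" if "n \<le> N" for n
    proof (rule H(3)[OF LI'], rule)
      fix a assume "a \<in> H n"
      then have "P n a \<in> I'" "degree (P n a) \<le> n" "coeff (P n a) n = a"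
        using P[of a n] H(2)[of n] BI that by (auto simp: I'_def B_def subset_iff)
      then show "a \<in> leading_coeffs I' n" unfolding leading_coeffs_def by (intro CollectI exI[of _ "P n a"]) simp
    qed
    have *: "L n \<subseteq> leading_coeffs I' n" for n
    proof (cases "n \<le> N")
      case False
      then have "leading_coeffs I' N \<subseteq> leading_coeffs I' n" by (intro monoI') simp
      then show ?thesis using low[OF order.refl] N[of n] by blast
    qed (rule low)
    fix f assume "f \<in> J"
    then show "f \<in> I"
    proof (induction "degree f" arbitrary: f rule: less_induct)
      case less
      have "coeff f (degree f) \<in> L (degree f)"
        unfolding L_def leading_coeffs_def using less.prems by auto
      then obtain p where p: "p \<in> I'" "degree p \<le> degree f" "coeff p (degree f) = coeff f (degree f)"
        using *[of "degree f"] by (auto simp: leading_coeffs_def)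
      have fp: "f - p \<in> J" using type_ideal_diff[OF J] less.prems p by (auto simp: I'_def)
      have "f - p \<in> I"
      proof (cases "degree f = 0")
        case True
        then have "f = p" using p by (intro poly_eqI2) auto
        then show ?thesis by (simp add: type_ideal_zero[OF I])
      next
        case False
        then have "degree (f - p) < degree f"
          using p by (intro degree_lessI) (auto simp: coeff_eq_0 le_eq_less_or_eq)
        then show ?thesis using less.hyps fp by blast
      qed
      then show ?case
        using type_ideal_add[OF I, of "f - p" p] p by (simp add: I'_def)
    qed
  qed
  ultimately show ?thesis
    unfolding finitely_generated_def by blast
qed

section \<open>Maximal ideals of \<open>k[s, t]\<close>\<close>

text \<open>Let \<open>F\<close> be a nonzero element of least degree in \<open>t\<close>, with leading coefficient \<open>a\<close>. If no
  nonzero polynomial in \<open>s\<close> were in \<open>M\<close>, then reducing an inverse of \<open>p = 1 + s a\<close> modulo \<open>F\<close> would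
  show that \<open>p\<close> divides a power of \<open>a\<close>, although \<open>p\<close> is coprime to \<open>a\<close>.\<close>

lemma maximal_ideal_poly_poly_contains_constant:
  fixes M :: "'k::field poly poly set"
  assumes M: "type_ideal M" "1 \<notin> M" and max: "\<And>f. f \<notin> M \<Longrightarrow> \<exists>g. f * g - 1 \<in> M"
  shows "\<exists>p. p \<noteq> 0 \<and> [:p:] \<in> M"
proof (rule ccontr)
  assume "\<not> ?thesis"
  then have const: "p = 0" if "[:p:] \<in> M" for p
    using that by blast
  show False
  proof (cases "\<exists>F. F \<in> M \<and> F \<noteq> 0")
    case False
    \<comment> \<open>If \<open>M\<close> were zero, the inner variable \<open>s\<close> would be
      invertible in \<open>k[s, t]\<close>.\<close>
    have "[:[:0, 1:]:] \<notin> M" using const[of "[:0, 1:]"] by auto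
    from max[OF this] obtain g where "[:[:0, 1:]:] * g = (1 :: 'k poly poly)"
      using False by auto
    then have "coeff ([:[:0, 1:]:] * g) 0 = (1 :: 'k poly)" by simp
    then have "pCons 0 (coeff g 0) = 1" by simp
    then show False by (simp add: one_pCons)
  next
    case True
    then obtain F where F: "F \<in> M" "F \<noteq> 0" and min: "\<And>G. G \<in> M \<Longrightarrow> G \<noteq> 0 \<Longrightarrow> degree F \<le> degree G"
      using ex_has_least_nat[of "\<lambda>F. F \<in> M \<and> F \<noteq> 0" _ degree] by blast
    have deg: "degree F > 0"
    proof (rule ccontr)
      assume "\<not> degree F > 0"
      then obtain p where "F = [:p:]" using degree_eq_zeroE by blast
      then show False using F const[of p] by auto
    qed
    define a where "a = lead_coeff F"
    define p where "p = 1 + [:0, 1:] * a"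
    have a: "a \<noteq> 0" using F by (simp add: a_def)
    have "coeff p 0 = 1" by (simp add: p_def)
    then have "p \<noteq> 0" by auto
    then have "[:p:] \<notin> M" using const by blast
    from max[OF this] obtain g where g: "[:p:] * g - 1 \<in> M" by blast
    \<comment> \<open>The exponent of the leading coefficient \<open>a\<close> by which
      pseudo-division of \<open>g\<close> by \<open>F\<close> multiplies \<open>g\<close>.\<close>
    define k where "k = Suc (degree g) - degree F"
    obtain q r where qr: "pseudo_divmod g F = (q, r)" by fastforce
    have r: "smult (a ^ k) g = F * q + r" "r = 0 \<or> degree r < degree F"
      using pseudo_divmod[OF F(2) qr] by (auto simp: a_def k_def)
    have "[:p:] * r - [:a ^ k:] = [:a ^ k:] * ([:p:] * g - 1) - [:p:] * q * F"
    proof -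
      have "P * (A * g - F * q) - A = A * (P * g - 1) - P * q * F" for A P :: "'k poly poly"
        by (simp add: algebra_simps)
      from this[of "[:p:]" "[:a ^ k:]"] show ?thesis using r(1) by simp
    qed
    moreover have "[:a ^ k:] * ([:p:] * g - 1) - [:p:] * q * F \<in> M"
      by (intro type_ideal_diff[OF M(1)] type_ideal_mult_left[OF M(1)] g F(1))
    ultimately have "[:p:] * r - [:a ^ k:] \<in> M" by (simp only:)
    moreover have "degree ([:p:] * r - [:a ^ k:]) < degree F"
      using r(2) deg degree_smult_le[of p r] by (auto intro!: degree_diff_less)
    ultimately have "[:p:] * r - [:a ^ k:] = 0"
      using min by (meson leD)
    then have "[:p:] * r = [:a ^ k:]" by (simp only: right_minus_eq)
    then have "coeff ([:p:] * r) 0 = a ^ k" by simp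
    then have "p * coeff r 0 = a ^ k" by simp
    then have "p dvd a ^ k" by (metis dvd_triv_left)
    \<comment> \<open>Coprimality of \<open>p\<close> and \<open>a\<close> as a cancellation law,
      from \<open>p - s a = 1\<close>.\<close>
    have cancel: "p dvd e" if "p dvd a * e" for e
    proof -
      have "e = p * e - [:0, 1:] * (a * e)" by (simp add: p_def algebra_simps)
      then show ?thesis using that by (metis dvd_diff dvd_mult dvd_triv_left)
    qed
    have "p dvd a ^ j \<Longrightarrow> p dvd 1" for j
      by (induction j) (auto dest: cancel)
    then have "is_unit p" using \<open>p dvd a ^ k\<close> by blast
    then have "degree p = 0" by (simp add: is_unit_iff_degree \<open>p \<noteq> 0\<close>)
    moreover have "coeff p (Suc (degree a)) = lead_coeff a"
      by (simp add: p_def coeff_pCons coeff_eq_0)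
    ultimately show False using a by (simp add: coeff_eq_0)
  qed
qed

text \<open>The contraction of \<open>M\<close> to \<open>k[s]\<close> is a nonzero prime ideal. By
  division with remainder an element of least degree generates it, and is therefore prime.\<close>

lemma prime_ideal_contains_prime_constant:
  fixes M :: "'k::field poly poly set"
  assumes M: "type_ideal M" "1 \<notin> M" and prime: "\<And>f g. f * g \<in> M \<Longrightarrow> f \<in> M \<or> g \<in> M"
    and p: "p \<noteq> 0" "[:p:] \<in> M"
  shows "\<exists>r. prime_elem r \<and> [:r:] \<in> M"
proof -
  obtain r where r: "r \<noteq> 0" "[:r:] \<in> M"
    and min: "\<And>q. [:q:] \<in> M \<Longrightarrow> q \<noteq> 0 \<Longrightarrow> degree r \<le> degree q"
    using p ex_has_least_nat[of "\<lambda>r. [:r:] \<in> M \<and> r \<noteq> 0" p degree] by blast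
  have dvd: "r dvd q" if "[:q:] \<in> M" for q
  proof -
    have "[:q mod r:] = [:q:] - [:q div r:] * [:r:]"
      by (simp add: minus_mult_div_eq_mod)
    also have "\<dots> \<in> M"
      by (intro type_ideal_diff[OF M(1)] type_ideal_mult_left[OF M(1)] that r)
    finally have "q mod r = 0"
      using min[of "q mod r"] degree_mod_less[OF r(1), of q] leD by blast
    then show ?thesis by (simp add: mod_eq_0_iff_dvd)
  qed
  have "\<not> r dvd 1"
  proof
    assume "r dvd 1"
    then obtain u where "1 = r * u" by (elim dvdE)
    then have "1 = [:u:] * [:r:]" by (simp add: mult.commute one_pCons)
    then show False using type_ideal_mult_left[OF M(1) r(2), of "[:u:]"] M(2) by simp
  qed
  moreover have "r dvd a \<or> r dvd b" if "r dvd a * b" for a b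
  proof -
    from that obtain u where "a * b = r * u" by (elim dvdE)
    then have "[:a:] * [:b:] = [:u:] * [:r:]" by (simp add: mult.commute)
    then have "[:a:] * [:b:] \<in> M" using type_ideal_mult_left[OF M(1) r(2), of "[:u:]"] by simp
    then show ?thesis using prime dvd by blast
  qed
  ultimately show ?thesis
    using r by (auto simp: prime_elem_def)
qed

section \<open>Algebraic dependence and chains of ideals\<close>

text \<open>One step of Gaussian elimination per equation: a pivot \<open>n0\<close> in the row
  \<open>e\<close> is cleared from the other rows, and its value is recovered from the row
  \<open>e\<close> afterwards.\<close>

lemma homogeneous_linear_system:
  fixes A :: "'e \<Rightarrow> 'n \<Rightarrow> 'k::field"
  assumes "finite E" "finite N" "card E < card N"
  shows "\<exists>c. (\<exists>n\<in>N. c n \<noteq> 0) \<and> (\<forall>e\<in>E. (\<Sum>n\<in>N. A e n * c n) = 0)"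
  using assms
proof (induction E arbitrary: N A rule: finite_induct)
  case empty
  then show ?case by (intro exI[of _ "\<lambda>_. 1"]) (auto simp: card_gt_0_iff)
next
  case (insert e E)
  show ?case
  proof (cases "\<exists>n0\<in>N. A e n0 \<noteq> 0")
    case False
    have "card E < card N" using insert by simp
    from insert.IH[OF insert.prems(1) this, of A] show ?thesis using False by auto
  next
    case True
    then obtain n0 where n0: "n0 \<in> N" "A e n0 \<noteq> 0" by blast
    define A' where "A' = (\<lambda>f n. A f n - A f n0 * A e n / A e n0)"
    have "finite (N - {n0})" "card E < card (N - {n0})"
      using insert n0 by auto
    from insert.IH[OF this, of A'] obtain c where
      c: "\<exists>n\<in>N-{n0}. c n \<noteq> 0" "\<And>f. f \<in> E \<Longrightarrow> (\<Sum>n\<in>N-{n0}. A' f n * c n) = 0" by blast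
    define s where "s = (\<Sum>n\<in>N-{n0}. A e n * c n)"
    define d where "d = c(n0 := - s / A e n0)"
    have sum: "(\<Sum>n\<in>N. A f n * d n) = (\<Sum>n\<in>N-{n0}. A f n * c n) - A f n0 * s / A e n0" for f
    proof -
      have "(\<Sum>n\<in>N. A f n * d n) = A f n0 * d n0 + (\<Sum>n\<in>N-{n0}. A f n * d n)"
        using insert.prems(1) n0(1) by (rule sum.remove)
      also have "(\<Sum>n\<in>N-{n0}. A f n * d n) = (\<Sum>n\<in>N-{n0}. A f n * c n)"
        by (rule sum.cong) (auto simp: d_def)
      finally show ?thesis by (simp add: d_def)
    qed
    have "(\<Sum>n\<in>N. A f n * d n) = 0" if "f \<in> insert e E" for f
    proof (cases "f = e")
      case True
      then show ?thesis using n0 by (simp add: sum s_def)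
    next
      case False
      then have "0 = (\<Sum>n\<in>N-{n0}. A' f n * c n)" using c(2) that by auto
      also have "\<dots> = (\<Sum>n\<in>N-{n0}. A f n * c n) - A f n0 * s / A e n0"
        by (simp add: A'_def s_def left_diff_distrib sum_subtractf sum_distrib_left sum_divide_distrib mult.assoc)
      finally show ?thesis by (simp add: sum)
    qed
    moreover have "\<exists>n\<in>N. d n \<noteq> 0" using c(1) by (auto simp: d_def)
    ultimately show ?thesis by blast
  qed
qed

text \<open>If the constant term is marked, it lies in \<open>J'\<close> because \<open>x\<close>
  does; if not, it is zero and regularity allows division by \<open>x\<close>. The mark
  \<open>nz\<close> is kept apart from \<open>r i \<noteq> 0\<close> because \<open>r i\<close> will
  itself be a polynomial expression, which may be zero in the ring although its coefficients are
  not.\<close>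

lemma lowest_coefficient_in_ideal:
  assumes J: "type_ideal J'" "J \<subseteq> J'" "x \<in> J'" and reg: "\<And>y. x * y \<in> J \<Longrightarrow> y \<in> J"
    and "(\<Sum>i<N. r i * x ^ i) \<in> J" "\<exists>i<N. nz i" "\<And>i. i < N \<Longrightarrow> \<not> nz i \<Longrightarrow> r i = 0"
  shows "\<exists>i<N. nz i \<and> r i \<in> J'"
  using assms(5-)
proof (induction N arbitrary: r nz)
  case (Suc N)
  have eq: "(\<Sum>i<Suc N. r i * x ^ i) = r 0 + x * (\<Sum>i<N. r (Suc i) * x ^ i)"
    by (simp only: sum.lessThan_Suc_shift) (simp add: sum_distrib_left mult_ac)
  show ?case
  proof (cases "nz 0")
    case True
    have "r 0 + x * (\<Sum>i<N. r (Suc i) * x ^ i) \<in> J'" using Suc.prems(1) J(2) eq by auto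
    moreover have "x * (\<Sum>i<N. r (Suc i) * x ^ i) \<in> J'" using J by (simp add: type_ideal_mult_right)
    ultimately have "r 0 \<in> J'" using type_ideal_diff[OF J(1)] by fastforce
    then show ?thesis using True by auto
  next
    case False
    then have "x * (\<Sum>i<N. r (Suc i) * x ^ i) \<in> J" using Suc.prems(1,3) eq by auto
    then have "(\<Sum>i<N. r (Suc i) * x ^ i) \<in> J" by (rule reg)
    moreover have "\<exists>i<N. nz (Suc i)"
      using Suc.prems(2) False by (metis less_Suc_eq_0_disj)
    ultimately have "\<exists>i<N. nz (Suc i) \<and> r (Suc i) \<in> J'"
      using Suc.prems(3) by (intro Suc.IH) auto
    then show ?thesis by auto
  qed
qed auto

text \<open>Covers regular sequences, with \<open>J i\<close> generated by the first \<open>i\<close> elements, as well as chains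
  of primes, with \<open>x i\<close> in \<open>J (i + 1)\<close> but not in \<open>J i\<close>.\<close>

lemma regular_chain_of_dependent:
  fixes h :: "'k::field \<Rightarrow> 'a::comm_ring_1"
  assumes h: "type_ring_hom h"
    and J: "\<And>i. i < 4 \<Longrightarrow> type_ideal (J i)" "\<And>i. i < 3 \<Longrightarrow> J i \<subseteq> J (Suc i)"
    and x: "\<And>i. i < 3 \<Longrightarrow> x i \<in> J (Suc i)" "\<And>i y. i < 3 \<Longrightarrow> x i * y \<in> J i \<Longrightarrow> y \<in> J i"
    and dep: "(\<Sum>a<N. (\<Sum>b<N. (\<Sum>c<N. h (k a b c) * x 2 ^ c) * x 1 ^ b) * x 0 ^ a) \<in> J 0"
    and nz: "\<exists>a<N. \<exists>b<N. \<exists>c<N. k a b c \<noteq> 0"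
  shows "1 \<in> J (3::nat)"
proof -
  interpret type_ring_hom h by fact
  \<comment> \<open>Taking lowest coefficients in \<open>x 0\<close>, \<open>x 1\<close> and
    \<open>x 2\<close> in turn moves up one ideal each time and ends with a nonzero constant in
    \<open>J 3\<close>.\<close>
  have "\<exists>a<N. (\<exists>b<N. \<exists>c<N. k a b c \<noteq> 0) \<and> (\<Sum>b<N. (\<Sum>c<N. h (k a b c) * x 2 ^ c) * x 1 ^ b) \<in> J 1"
    using J(1)[of 1] J(2)[of 0] x(1)[of 0] x(2)[of 0] dep nz
    by (intro lowest_coefficient_in_ideal[of "J 1" "J 0" "x 0"]) (auto simp: hom_zero intro!: sum.neutral)
  then obtain a where a: "a < N" "\<exists>b<N. \<exists>c<N. k a b c \<noteq> 0"
    "(\<Sum>b<N. (\<Sum>c<N. h (k a b c) * x 2 ^ c) * x 1 ^ b) \<in> J 1" by blast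
  have "\<exists>b<N. (\<exists>c<N. k a b c \<noteq> 0) \<and> (\<Sum>c<N. h (k a b c) * x 2 ^ c) \<in> J 2"
    using J(1)[of 2] J(2)[of 1] x(1)[of 1] x(2)[of 1] a
    by (intro lowest_coefficient_in_ideal[of "J 2" "J 1" "x 1"])
      (auto simp: hom_zero numeral_2_eq_2 intro!: sum.neutral)
  then obtain b where b: "\<exists>c<N. k a b c \<noteq> 0" "(\<Sum>c<N. h (k a b c) * x 2 ^ c) \<in> J 2" by blast
  have "\<exists>c<N. k a b c \<noteq> 0 \<and> h (k a b c) \<in> J 3"
    using J(1)[of 3] J(2)[of 2] x(1)[of 2] x(2)[of 2] b
    by (intro lowest_coefficient_in_ideal[of "J 3" "J 2" "x 2"]) (auto simp: hom_zero numeral_3_eq_3 numeral_2_eq_2)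
  then obtain c where c: "k a b c \<noteq> 0" "h (k a b c) \<in> J 3" by blast
  have "h (inverse (k a b c)) * h (k a b c) = 1"
    using c(1) by (simp add: hom_one flip: hom_mult)
  then show ?thesis
    using type_ideal_mult_left[OF J(1)[of 3] c(2), of "h (inverse (k a b c))"] by simp
qed

section \<open>The ideal of a set of points\<close>

text \<open>An infinite field stays infinite without zero. Only nonzero parameters are available,
  since a class in \<open>proj_space\<close> consists of nonzero multiples of a vector.\<close>

lemma poly_poly_eq_0I:
  fixes F :: "'k::field_char_0 poly poly"
  assumes "\<And>c d. c \<noteq> 0 \<Longrightarrow> d \<noteq> 0 \<Longrightarrow> poly (poly F [:d:]) c = 0"
  shows "F = 0"
proof -
  have inf: "infinite {c::'k. c \<noteq> 0}"
    using infinite_UNIV_char_0 by (auto simp: Collect_neg_eq finite_compl)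
  have "poly F [:d:] = 0" if "d \<noteq> 0" for d
  proof (rule ccontr)
    assume "poly F [:d:] \<noteq> 0"
    then have "finite {c. poly (poly F [:d:]) c = 0}" by (rule poly_roots_finite)
    then have "finite {c::'k. c \<noteq> 0}" by (rule finite_subset[rotated]) (use assms that in auto)
    then show False using inf by blast
  qed
  then have "(\<lambda>d. [:d:]) ` {d. d \<noteq> 0} \<subseteq> {p. poly F p = 0}" by auto
  moreover have "infinite ((\<lambda>d::'k. [:d:]) ` {d. d \<noteq> 0})"
    using inf by (subst finite_image_iff) (auto simp: inj_on_def)
  ultimately have "infinite {p. poly F p = 0}" using finite_subset by blast
  then show ?thesis using poly_roots_finite by blast
qed

text \<open>Restriction to the plane spanned by the lines through \<open>v\<close> and \<open>w\<close>, parametrised by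
  \<open>x = s v\<close>, \<open>y = t w\<close>; the outer polynomial variable is \<open>t\<close>.\<close>

definition restrict_plane ::
  "('m::finite \<Rightarrow> 'k::field) \<Rightarrow> ('n::finite \<Rightarrow> 'k) \<Rightarrow> ('m + 'n, 'k) mpoly \<Rightarrow> 'k poly poly" where
  "restrict_plane v w = mpoly_hom (\<lambda>a. [:[:a:]:])
     (case_sum (\<lambda>i. monom (monom (v i) 1) 0) (\<lambda>j. monom (monom (w j) 0) 1))"

lemma type_ring_hom_const_poly_poly: "type_ring_hom (\<lambda>a::'k::field. [:[:a:]:])"
  by unfold_locales (auto simp: one_pCons)

lemma type_ring_hom_restrict_plane: "type_ring_hom (restrict_plane v w)"
  unfolding restrict_plane_def
  by (rule type_ring_hom.type_ring_hom_mpoly_hom[OF type_ring_hom_const_poly_poly])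

lemma restrict_plane_const [simp]: "restrict_plane v w (mpoly_const a) = [:[:a:]:]"
  unfolding restrict_plane_def
  by (rule type_ring_hom.mpoly_hom_const[OF type_ring_hom_const_poly_poly])

lemma restrict_plane_var [simp]:
  "restrict_plane v w (mpoly_var (Inl i)) = monom (monom (v i) 1) 0"
  "restrict_plane v w (mpoly_var (Inr j)) = monom (monom (w j) 0) 1"
  unfolding restrict_plane_def
  by (simp_all add: type_ring_hom.mpoly_hom_var[OF type_ring_hom_const_poly_poly])

lemma poly_restrict_plane:
  "poly (poly (restrict_plane v w f) [:d:]) c =
     mpoly_eval (case_sum (\<lambda>i. c * v i) (\<lambda>j. d * w j)) f"
proof -
  have "type_ring_hom (\<lambda>f. poly (poly (restrict_plane v w f) [:d:]) c)"
    by (rule type_ring_hom_comp[OF type_ring_hom_poly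
          type_ring_hom_comp[OF type_ring_hom_poly type_ring_hom_restrict_plane]])
  then show ?thesis
    by (rule mpoly_hom_unique[OF _ type_ring_hom_mpoly_eval])
      (auto simp: poly_monom split: sum.split elim!: sumE intro: sumE)
qed

section \<open>Bihomogeneous components\<close>

definition bidegree :: "('m::finite + 'n::finite \<Rightarrow>\<^sub>0 nat) \<Rightarrow> nat \<times> nat" where
  "bidegree m = (\<Sum>i\<in>UNIV. Poly_Mapping.lookup m (Inl i), \<Sum>j\<in>UNIV. Poly_Mapping.lookup m (Inr j))"

definition bihom_component ::
  "nat \<times> nat \<Rightarrow> ('m::finite + 'n::finite, 'k::comm_ring_1) mpoly \<Rightarrow> ('m + 'n, 'k) mpoly" where
  "bihom_component de f =
     (\<Sum>m \<in> {m \<in> Poly_Mapping.keys f. bidegree m = de}. Poly_Mapping.single m (Poly_Mapping.lookup f m))"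

lemma bihomogeneous_bihom_component: "bihomogeneous d e (bihom_component (d, e) f)"
  unfolding bihomogeneous_def
proof
  fix m assume "m \<in> Poly_Mapping.keys (bihom_component (d, e) f)"
  then have "bidegree m = (d, e)"
    unfolding bihom_component_def
    by (auto simp: in_keys_iff lookup_sum lookup_single when_def elim!: sum.not_neutral_contains_not_neutral split: if_splits)
  then show "(\<Sum>i\<in>UNIV. Poly_Mapping.lookup m (Inl i)) = d \<and> (\<Sum>j\<in>UNIV. Poly_Mapping.lookup m (Inr j)) = e"
    by (simp add: bidegree_def)
qed

lemma sum_bihom_component: "(\<Sum>de \<in> bidegree ` Poly_Mapping.keys f. bihom_component de f) = f"
proof -
  have "f = (\<Sum>m \<in> Poly_Mapping.keys f. Poly_Mapping.single m (Poly_Mapping.lookup f m))"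
    by (rule poly_mapping_eq_sum_single)
  also have "\<dots> = (\<Sum>de \<in> bidegree ` Poly_Mapping.keys f. bihom_component de f)"
    unfolding bihom_component_def by (rule sum.image_gen) simp
  finally show ?thesis by simp
qed

lemma monom_prod: "finite A \<Longrightarrow> (\<Prod>i\<in>A. monom (a i) (k i)) = monom (prod a A) (sum k A)"
  for a :: "'i \<Rightarrow> 'a::comm_ring_1"
  by (induction A rule: finite_induct) (simp_all add: mult_monom)

lemma restrict_plane_single:
  "restrict_plane v w (Poly_Mapping.single m a) =
     monom (monom (a * monom_eval (case_sum v w) m) (fst (bidegree m))) (snd (bidegree m))"
proof -
  have split: "prod F UNIV = (\<Prod>i\<in>UNIV. F (Inl i)) * (\<Prod>j\<in>UNIV. F (Inr j))"
    for F :: "'p::finite + 'q::finite \<Rightarrow> 'z::comm_ring_1"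
    using prod.Plus[of UNIV UNIV F] by (simp add: comp_def)
  show ?thesis
    unfolding restrict_plane_def type_ring_hom.mpoly_hom_single[OF type_ring_hom_const_poly_poly]
    by (simp add: monom_eval_def split monom_power monom_prod mult_monom bidegree_def smult_monom)
qed

text \<open>Substituting \<open>s v\<close> and \<open>t w\<close> turns the bigrading into powers
  of \<open>s\<close> and \<open>t\<close>. Hence a polynomial has zero restriction to the plane
  exactly when all its components vanish at \<open>(v, w)\<close>.\<close>

lemma coeff_restrict_plane:
  "coeff (coeff (restrict_plane v w f) e) d = mpoly_eval (case_sum v w) (bihom_component (d, e) f)"
proof -
  interpret type_ring_hom "restrict_plane v w" by (rule type_ring_hom_restrict_plane)
  interpret ev: type_ring_hom "mpoly_eval (case_sum v w)" by (rule type_ring_hom_mpoly_eval)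
  have "coeff (coeff (restrict_plane v w f) e) d =
      (\<Sum>m \<in> Poly_Mapping.keys f. coeff (coeff
         (restrict_plane v w (Poly_Mapping.single m (Poly_Mapping.lookup f m))) e) d)"
    by (subst poly_mapping_eq_sum_single[of f]) (simp add: hom_sum coeff_sum)
  also have "\<dots> = (\<Sum>m \<in> Poly_Mapping.keys f. if bidegree m = (d, e)
      then Poly_Mapping.lookup f m * monom_eval (case_sum v w) m else 0)"
    by (intro sum.cong refl) (auto simp: restrict_plane_single prod_eq_iff)
  also have "\<dots> = (\<Sum>m \<in> {m \<in> Poly_Mapping.keys f. bidegree m = (d, e)}.
      Poly_Mapping.lookup f m * monom_eval (case_sum v w) m)"
    by (simp add: sum.inter_filter)
  also have "\<dots> = mpoly_eval (case_sum v w) (bihom_component (d, e) f)"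
    unfolding bihom_component_def ev.hom_sum
    by (simp add: mpoly_eval_eq_mpoly_hom type_ring_hom.mpoly_hom_single[OF type_ring_hom_id])
  finally show ?thesis .
qed

text \<open>A nonzero coordinate of \<open>v\<close> and one of \<open>w\<close>, suitably rescaled,
  are sent to \<open>s\<close> and \<open>t\<close>.\<close>

lemma surj_restrict_plane:
  assumes "v \<noteq> (\<lambda>_. 0)" "w \<noteq> (\<lambda>_. 0)"
  shows "surj (restrict_plane v w)"
proof -
  interpret type_ring_hom "restrict_plane v w" by (rule type_ring_hom_restrict_plane)
  let ?R = "range (restrict_plane v w)"
  have add: "F + G \<in> ?R" if FG: "F \<in> ?R" "G \<in> ?R" for F G
    using FG by (auto simp flip: hom_add)
  have mult: "F * G \<in> ?R" if FG: "F \<in> ?R" "G \<in> ?R" for F G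
    using FG by (auto simp flip: hom_mult)
  have const: "[:[:a:]:] \<in> ?R" for a
    by (metis restrict_plane_const rangeI)
  obtain i j where ij: "v i \<noteq> 0" "w j \<noteq> 0" using assms by (auto simp: fun_eq_iff)
  have "restrict_plane v w (mpoly_const (inverse (v i)) * mpoly_var (Inl i)) = [:[:0, 1:]:]"
    using ij by (simp add: hom_mult monom_0 monom_Suc)
  then have s: "[:[:0, 1:]:] \<in> ?R" by (metis rangeI)
  have "restrict_plane v w (mpoly_const (inverse (w j)) * mpoly_var (Inr j)) = [:0, 1:]"
    using ij by (simp add: hom_mult monom_0 monom_Suc one_pCons)
  then have t: "[:0, 1:] \<in> ?R" by (metis rangeI)
  have p: "[:p:] \<in> ?R" for p
  proof (induction p)
    case 0 then show ?case using const[of 0] by simp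
  next
    case (pCons a p)
    have "[:pCons a p:] = [:[:a:]:] + [:[:0, 1:]:] * [:p:]" by simp
    then show ?case using add mult const s pCons by metis
  qed
  have "F \<in> ?R" for F
  proof (induction F)
    case 0 then show ?case using p[of 0] by simp
  next
    case (pCons p' F)
    have "pCons p' F = [:p':] + [:0, 1:] * F" by simp
    then show ?case using add mult p t pCons by metis
  qed
  then show ?thesis by blast
qed

lemma ideal_ring_of_type_algebra_iff:
  "ideal J (ring_of_type_algebra :: 'a::comm_ring_1 ring) \<longleftrightarrow> type_ideal J"
proof
  assume "ideal J (ring_of_type_algebra :: 'a ring)"
  then interpret ideal J "ring_of_type_algebra :: 'a ring" .
  show "type_ideal J"
    unfolding type_ideal_def using additive_subgroup.zero_closed[OF is_additive_subgroup]
      additive_subgroup.a_closed[OF is_additive_subgroup] I_l_closed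
    by (auto simp: ring_of_type_algebra_def)
next
  assume J: "type_ideal J"
  interpret cring "ring_of_type_algebra :: 'a ring" by (rule cring_from_type_algebra)
  have inv: "\<ominus>\<^bsub>ring_of_type_algebra\<^esub> a = - a" for a :: 'a
    by (rule minus_equality) (auto simp: ring_of_type_algebra_def)
  show "ideal J (ring_of_type_algebra :: 'a ring)"
  proof (rule idealI)
    show "subgroup J (add_monoid (ring_of_type_algebra :: 'a ring))"
    proof
      fix x assume "x \<in> J"
      then show "inv\<^bsub>add_monoid ring_of_type_algebra\<^esub> x \<in> J"
        using inv[of x] type_ideal_uminus[OF J] by (simp add: a_inv_def)
    qed (use J in \<open>auto simp: type_ideal_def ring_of_type_algebra_def\<close>)
  qed (use J ring_from_type_algebra in
      \<open>auto simp: type_ideal_mult_left type_ideal_mult_right ring_of_type_algebra_def\<close>)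
qed

definition vanishing_ideal ::
  "(('m::finite \<Rightarrow> 'k::field) set \<times> ('n::finite \<Rightarrow> 'k) set) set \<Rightarrow> ('m + 'n, 'k) mpoly set" where
  "vanishing_ideal Z = {f. \<forall>(P, Q) \<in> Z. \<forall>v \<in> P. \<forall>w \<in> Q. mpoly_eval (case_sum v w) f = 0}"

lemma type_ideal_vanishing_ideal: "type_ideal (vanishing_ideal Z)"
  unfolding type_ideal_def vanishing_ideal_def
  by (fastforce simp: type_ring_hom.hom_zero[OF type_ring_hom_mpoly_eval]
      type_ring_hom.hom_add[OF type_ring_hom_mpoly_eval] type_ring_hom.hom_mult[OF type_ring_hom_mpoly_eval])

lemma proj_space_eq:
  assumes "P \<in> proj_space" "v \<in> P"
  shows "P = {(\<lambda>i. c * v i) |c. c \<noteq> 0}" "v \<noteq> (\<lambda>_. 0)"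
proof -
  obtain u where u: "P = {(\<lambda>i. c * u i) |c. c \<noteq> 0}" "u \<noteq> (\<lambda>_. 0)"
    using assms(1) by (auto simp: proj_space_def)
  then obtain b where b: "b \<noteq> 0" "v = (\<lambda>i. b * u i)" using assms(2) by auto
  show "v \<noteq> (\<lambda>_. 0)" using b u by (auto simp: fun_eq_iff)
  have "\<exists>c'. (\<lambda>i. c * u i) = (\<lambda>i. c' * v i) \<and> c' \<noteq> 0" if "c \<noteq> 0" for c
    using b that by (intro exI[of _ "c / b"]) auto
  moreover have "\<exists>c'. (\<lambda>i. c * v i) = (\<lambda>i. c' * u i) \<and> c' \<noteq> 0" if "c \<noteq> 0" for c
    using b that by (intro exI[of _ "c * b"]) auto
  ultimately show "P = {(\<lambda>i. c * v i) |c. c \<noteq> 0}"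
    unfolding u(1) by blast
qed

lemma proj_space_nonempty: "P \<in> proj_space \<Longrightarrow> \<exists>v. v \<in> P"
  using zero_neq_one[THEN not_sym] by (auto simp: proj_space_def)

lemma proj_space_scale: "P \<in> proj_space \<Longrightarrow> v \<in> P \<Longrightarrow> c \<noteq> 0 \<Longrightarrow> (\<lambda>i. c * v i) \<in> P"
  using proj_space_eq(1)[of P v] by blast

lemma vanishes_on_plane_iff:
  fixes P :: "('m::finite \<Rightarrow> 'k::field_char_0) set" and Q :: "('n::finite \<Rightarrow> 'k) set"
  assumes "P \<in> proj_space" "Q \<in> proj_space" "v \<in> P" "w \<in> Q"
  shows "(\<forall>v \<in> P. \<forall>w \<in> Q. mpoly_eval (case_sum v w) f = 0) \<longleftrightarrow> restrict_plane v w f = 0"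
proof
  assume "\<forall>v \<in> P. \<forall>w \<in> Q. mpoly_eval (case_sum v w) f = 0"
  then show "restrict_plane v w f = 0"
    using assms by (intro poly_poly_eq_0I) (auto simp: poly_restrict_plane proj_space_scale)
next
  assume *: "restrict_plane v w f = 0"
  show "\<forall>v \<in> P. \<forall>w \<in> Q. mpoly_eval (case_sum v w) f = 0"
  proof (intro ballI)
    fix v' w' assume "v' \<in> P" "w' \<in> Q"
    then obtain c d where "v' = (\<lambda>i. c * v i)" "w' = (\<lambda>i. d * w i)"
      using proj_space_eq(1)[OF assms(1,3)] proj_space_eq(1)[OF assms(2,4)] by auto
    then show "mpoly_eval (case_sum v' w') f = 0"
      using poly_restrict_plane[of v w f d c] * by simp
  qed
qed

text \<open>For the harder inclusion: the components of a polynomial vanishing on the planes have as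
  values the coefficients of its zero restrictions, so each component is one of the generators of
  \<open>biproj_ideal Z\<close>.\<close>

lemma biproj_ideal_eq_vanishing_ideal:
  fixes Z :: "(('m::finite \<Rightarrow> 'k::field_char_0) set \<times> ('n::finite \<Rightarrow> 'k) set) set"
  assumes Z: "Z \<subseteq> proj_space \<times> proj_space"
  shows "biproj_ideal Z = vanishing_ideal Z"
proof
  interpret cring "ring_of_type_algebra :: ('m + 'n, 'k) mpoly ring" by (rule cring_from_type_algebra)
  have carrier: "carrier (ring_of_type_algebra :: ('m + 'n, 'k) mpoly ring) = UNIV"
    by (simp add: ring_of_type_algebra_def)
  show "biproj_ideal Z \<subseteq> vanishing_ideal Z"
    unfolding biproj_ideal_def
    by (rule genideal_minimal)
      (auto simp: ideal_ring_of_type_algebra_iff vanishing_ideal_def type_ideal_vanishing_ideal[unfolded vanishing_ideal_def])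
  show "vanishing_ideal Z \<subseteq> biproj_ideal Z"
  proof
    fix f assume f: "f \<in> vanishing_ideal Z"
    let ?G = "{f :: ('m + 'n, 'k) mpoly. (\<exists>d e. bihomogeneous d e f) \<and>
           (\<forall>(P, Q) \<in> Z. \<forall>v \<in> P. \<forall>w \<in> Q. mpoly_eval (case_sum v w) f = 0)}"
    have "type_ideal (biproj_ideal Z)"
      unfolding biproj_ideal_def ideal_ring_of_type_algebra_iff[symmetric]
      by (rule genideal_ideal) (simp add: carrier)
    moreover have "bihom_component de f \<in> biproj_ideal Z" for de
    proof -
      have "mpoly_eval (case_sum v w) (bihom_component de f) = 0"
        if "(P, Q) \<in> Z" "v \<in> P" "w \<in> Q" for P Q v w
      proof -
        have "restrict_plane v w f = 0"
          using that f Z by (subst vanishes_on_plane_iff[symmetric, of P Q]) (auto simp: vanishing_ideal_def)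
        then show ?thesis
          using coeff_restrict_plane[of v w f "snd de" "fst de"] by simp
      qed
      moreover have "bihomogeneous (fst de) (snd de) (bihom_component de f)"
        using bihomogeneous_bihom_component[of "fst de" "snd de" f] by simp
      ultimately have "bihom_component de f \<in> ?G" by blast
      then show ?thesis
        unfolding biproj_ideal_def using genideal_self[of ?G] by (auto simp: carrier)
    qed
    ultimately have "(\<Sum>de \<in> bidegree ` Poly_Mapping.keys f. bihom_component de f) \<in> biproj_ideal Z"
      by (rule type_ideal_sum)
    then show "f \<in> biproj_ideal Z" by (simp add: sum_bihom_component)
  qed
qed

section \<open>Algebraic dependence by counting coefficients\<close>

definition bounded_degrees :: "nat \<Rightarrow> 'a::comm_ring_1 poly poly \<Rightarrow> bool" where
  "bounded_degrees D F \<longleftrightarrow> degree F \<le> D \<and> (\<forall>i. degree (coeff F i) \<le> D)"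

lemma bounded_degrees_mono: "bounded_degrees D F \<Longrightarrow> D \<le> E \<Longrightarrow> bounded_degrees E F"
  unfolding bounded_degrees_def using order.trans by blast

lemma bounded_degrees_exists: "\<exists>D. bounded_degrees D F"
proof -
  define D where "D = Max (insert (degree F) ((\<lambda>i. degree (coeff F i)) ` {..degree F}))"
  have "degree (coeff F i) \<le> D" for i
  proof (cases "i \<le> degree F")
    case True
    then show ?thesis unfolding D_def by (intro Max_ge) auto
  qed (simp add: coeff_eq_0)
  then have "bounded_degrees D F"
    unfolding bounded_degrees_def by (auto simp: D_def)
  then show ?thesis ..
qed

lemma bounded_degrees_mult:
  assumes "bounded_degrees D F" "bounded_degrees E G"
  shows "bounded_degrees (D + E) (F * G)"
proof -
  have "degree (F * G) \<le> D + E"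
    using degree_mult_le[of F G] assms by (auto simp: bounded_degrees_def)
  moreover have "degree (coeff (F * G) n) \<le> D + E" for n
    unfolding coeff_mult
  proof (rule degree_sum_le)
    fix i
    show "degree (coeff F i * coeff G (n - i)) \<le> D + E"
      using degree_mult_le[of "coeff F i" "coeff G (n - i)"] assms
      by (meson add_mono bounded_degrees_def order.trans)
  qed simp
  ultimately show ?thesis by (simp add: bounded_degrees_def)
qed

lemma bounded_degrees_power:
  assumes "bounded_degrees D F"
  shows "bounded_degrees (n * D) (F ^ n)"
proof (induction n)
  case 0
  then show ?case by (auto simp: bounded_degrees_def coeff_1)
next
  case (Suc n)
  then show ?case using bounded_degrees_mult[OF assms] by simp
qed

text \<open>There are \<open>N\<^sup>3\<close> monomials with exponents below \<open>N\<close>. On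
  each plane their images have degree at most \<open>3 * D * N\<close> in \<open>s\<close> and in
  \<open>t\<close>, so the number of linear conditions is only quadratic in
  \<open>N\<close>.\<close>

lemma algebraically_dependent_triple:
  fixes x :: "nat \<Rightarrow> 'a::comm_ring_1" and h :: "'k::field \<Rightarrow> 'a"
  assumes "finite Z" and \<phi>: "\<And>z. z \<in> Z \<Longrightarrow> type_ring_hom (\<phi> z)"
    "\<And>z a. z \<in> Z \<Longrightarrow> \<phi> z (h a) = [:[:a:]:]"
  shows "\<exists>N k. (\<exists>a<N. \<exists>b<N. \<exists>c<N. k a b c \<noteq> 0) \<and>
    (\<forall>z\<in>Z. \<phi> z (\<Sum>a<N. (\<Sum>b<N. (\<Sum>c<N. h (k a b c) * x 2 ^ c) * x 1 ^ b) * x 0 ^ a) = 0)"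
proof -
  obtain deg :: "'k poly poly \<Rightarrow> nat" where "\<And>F. bounded_degrees (deg F) F"
    using bounded_degrees_exists by metis
  then have d: "bounded_degrees (deg (\<phi> z (x i))) (\<phi> z (x i))" for z i .
  define d where "d = (\<lambda>z i. deg (\<phi> z (x i)))"
  have d: "bounded_degrees (d z i) (\<phi> z (x i))" for z i
    unfolding d_def by (rule d)
  \<comment> \<open>A sum rather than a maximum, so that an empty \<open>Z\<close> is no special
    case.\<close>
  define D where "D = (\<Sum>z\<in>Z. d z 0 + d z 1 + d z 2)"
  have D: "bounded_degrees D (\<phi> z (x i))" if "z \<in> Z" "i < 3" for z i
  proof -
    have "d z 0 + d z 1 + d z 2 \<le> D"
      unfolding D_def by (rule member_le_sum) (use that assms in auto)
    moreover have "i = 0 \<or> i = 1 \<or> i = 2" using that by auto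
    ultimately have "d z i \<le> D" by auto
    then show ?thesis using d bounded_degrees_mono by blast
  qed
  \<comment> \<open>Chosen so that \<open>card Z * (3 * D + 1)\<^sup>2 = N - 1\<close>. Since
    \<open>3 * D * N + 1 \<le> (3 * D + 1) * N\<close>, there are at most
    \<open>(N - 1) * N\<^sup>2\<close> equations for \<open>N\<^sup>3\<close> unknowns.\<close>
  define N where "N = card Z * (3 * D + 1)\<^sup>2 + 1"
  define mon where "mon = (\<lambda>(a, b, c). x 2 ^ c * x 1 ^ b * x 0 ^ a)"
  define I where "I = {..<N} \<times> {..<N} \<times> {..<N}"
  define E where "E = Z \<times> {..3 * D * N} \<times> {..3 * D * N}"
  have bound: "bounded_degrees (3 * D * N) (\<phi> z (mon n))" if z: "z \<in> Z" and nI: "n \<in> I" for z n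
  proof -
    interpret type_ring_hom "\<phi> z" by (rule \<phi>(1)[OF z])
    obtain a b c where n: "n = (a, b, c)" "a < N" "b < N" "c < N"
      using nI by (auto simp: I_def)
    have "bounded_degrees (c * D + b * D + a * D) (\<phi> z (mon n))"
      unfolding n mon_def prod.case hom_mult hom_power
      by (intro bounded_degrees_mult bounded_degrees_power D z) auto
    moreover have "c * D + b * D + a * D \<le> N * D + N * D + N * D"
      using n by (intro add_mono mult_right_mono) auto
    ultimately show ?thesis by (rule bounded_degrees_mono[OF _ order.trans]) simp
  qed
  have "(3 * D * N + 1)\<^sup>2 \<le> ((3 * D + 1) * N)\<^sup>2"
    by (intro power_mono) (auto simp: N_def)
  then have "card Z * (3 * D * N + 1)\<^sup>2 \<le> card Z * ((3 * D + 1) * N)\<^sup>2" by simp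
  also have "\<dots> = (N - 1) * N\<^sup>2"
    unfolding power_mult_distrib by (simp add: N_def flip: mult.assoc)
  also have "\<dots> < N * N\<^sup>2" by (rule mult_strict_right_mono) (auto simp: N_def)
  finally have "card Z * (3 * D * N + 1)\<^sup>2 < N * N\<^sup>2" .
  then have "card E < card I"
    by (simp add: E_def I_def card_cartesian_product power2_eq_square)
  moreover have "finite E" "finite I" using assms(1) by (auto simp: E_def I_def)
  ultimately obtain k where k: "\<exists>n\<in>I. k n \<noteq> 0"
    "\<And>e. e \<in> E \<Longrightarrow> (\<Sum>n\<in>I. (case e of (z, i, j) \<Rightarrow> coeff (coeff (\<phi> z (mon n)) i) j) * k n) = 0"
    using homogeneous_linear_system[of E I "\<lambda>e n. case e of (z, i, j) \<Rightarrow> coeff (coeff (\<phi> z (mon n)) i) j"]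
    by blast
  have "\<phi> z (\<Sum>n\<in>I. h (k n) * mon n) = 0" if z: "z \<in> Z" for z
  proof (intro poly_eqI)
    fix i j
    interpret type_ring_hom "\<phi> z" by (rule \<phi>(1)[OF z])
    have "coeff (coeff (\<phi> z (\<Sum>n\<in>I. h (k n) * mon n)) i) j =
        (\<Sum>n\<in>I. coeff (coeff (\<phi> z (mon n)) i) j * k n)"
      using z by (simp add: hom_sum hom_mult \<phi>(2) coeff_sum mult.commute)
    also have "\<dots> = 0"
    proof (cases "i \<le> 3 * D * N \<and> j \<le> 3 * D * N")
      case True
      then show ?thesis using k(2)[of "(z, i, j)"] z by (simp add: E_def)
    next
      case False
      then have "coeff (coeff (\<phi> z (mon n)) i) j = 0" if "n \<in> I" for n
        using bound[OF z that] unfolding bounded_degrees_def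
        by (metis coeff_0 coeff_eq_0 not_le order.strict_trans1)
      then show ?thesis by simp
    qed
    finally show "coeff (coeff (\<phi> z (\<Sum>n\<in>I. h (k n) * mon n)) i) j = coeff (coeff 0 i) j" by simp
  qed
  moreover have "(\<Sum>n\<in>I. h (k n) * mon n) =
     (\<Sum>a<N. (\<Sum>b<N. (\<Sum>c<N. h (k (a, b, c)) * x 2 ^ c) * x 1 ^ b) * x 0 ^ a)"
    by (simp add: I_def mon_def sum.cartesian_product' sum_distrib_right mult.assoc)
  ultimately show ?thesis
    using k(1) by (intro exI[of _ N] exI[of _ "\<lambda>a b c. k (a, b, c)"]) (auto simp: I_def)
qed

section \<open>Finite generation\<close>

text \<open>Induction on the number of maps: lifts of generators of \<open>\<phi> z\<close> followed
  by generators of the part of \<open>J\<close> killed by \<open>\<phi> z\<close>. This makes the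
  coordinate ring Noetherian because \<open>k[s, t]\<close> is; the Hilbert basis theorem is applied
  only to polynomials in one variable over a ring.\<close>

lemma finitely_generated_modulo_kernels:
  fixes \<phi> :: "'z \<Rightarrow> 'a::comm_ring_1 \<Rightarrow> 'b::comm_ring_1"
  assumes "finite Z" and \<phi>: "\<And>z. z \<in> Z \<Longrightarrow> type_ring_hom (\<phi> z)" "\<And>z. z \<in> Z \<Longrightarrow> surj (\<phi> z)"
    and noeth: "\<And>I :: 'b set. type_ideal I \<Longrightarrow> finitely_generated I"
    and "type_ideal J"
  shows "\<exists>G. finite G \<and> G \<subseteq> J \<and>
    (\<forall>I. type_ideal I \<longrightarrow> {f \<in> J. \<forall>z\<in>Z. \<phi> z f = 0} \<subseteq> I \<longrightarrow> G \<subseteq> I \<longrightarrow> J \<subseteq> I)"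
  using assms(1,5) \<phi>
proof (induction Z arbitrary: J rule: finite_induct)
  case empty
  then show ?case by (intro exI[of _ "{}"]) auto
next
  case (insert z Z)
  interpret type_ring_hom "\<phi> z" using insert by auto
  have image: "type_ideal (\<phi> z ` K)" if "type_ideal K" for K
    using that insert.prems by (intro type_ideal_image) auto
  define J' where "J' = {f \<in> J. \<phi> z f = 0}"
  have J': "type_ideal J'"
    unfolding J'_def using insert.prems(1) by (auto simp: type_ideal_def hom_zero hom_add hom_mult)
  have "\<exists>G. finite G \<and> G \<subseteq> J' \<and>
    (\<forall>I. type_ideal I \<longrightarrow> {f \<in> J'. \<forall>z\<in>Z. \<phi> z f = 0} \<subseteq> I \<longrightarrow> G \<subseteq> I \<longrightarrow> J' \<subseteq> I)"
    using insert.prems by (intro insert.IH J') auto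
  then obtain G where G: "finite G" "G \<subseteq> J'"
    "\<And>I. type_ideal I \<Longrightarrow> {f \<in> J'. \<forall>z\<in>Z. \<phi> z f = 0} \<subseteq> I \<Longrightarrow> G \<subseteq> I \<Longrightarrow> J' \<subseteq> I"
    by blast
  have "finitely_generated (\<phi> z ` J)"
    by (intro noeth image insert.prems)
  then obtain H where H: "finite H" "H \<subseteq> \<phi> z ` J"
    "\<And>I. type_ideal I \<Longrightarrow> H \<subseteq> I \<Longrightarrow> \<phi> z ` J \<subseteq> I"
    unfolding finitely_generated_def by blast
  obtain H' where H': "finite H'" "H' \<subseteq> J" "H = \<phi> z ` H'"
    using finite_subset_image[OF H(1,2)] by blast
  have "J \<subseteq> I" if I: "type_ideal I" "{f \<in> J. \<forall>z\<in>insert z Z. \<phi> z f = 0} \<subseteq> I" "G \<union> H' \<subseteq> I" for I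
  proof
    fix f assume f: "f \<in> J"
    have "J' \<subseteq> I" using I by (intro G(3)) (auto simp: J'_def)
    have "type_ideal (\<phi> z ` (I \<inter> J))"
      by (intro image type_ideal_Int I insert.prems)
    then have "\<phi> z ` J \<subseteq> \<phi> z ` (I \<inter> J)"
      by (rule H(3)) (use H' I(3) in auto)
    then obtain g where g: "g \<in> I" "g \<in> J" "\<phi> z f = \<phi> z g" using f by auto
    then have "f - g \<in> J'"
      using f type_ideal_diff[OF insert.prems(1)] by (auto simp: J'_def hom_diff)
    then show "f \<in> I"
      using type_ideal_add[OF I(1), of "f - g" g] \<open>J' \<subseteq> I\<close> g by auto
  qed
  moreover have "finite (G \<union> H')" "G \<union> H' \<subseteq> J" using G H' by (auto simp: J'_def)
  ultimately show ?case by blast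
qed

section \<open>Separating the two sets of variables\<close>

definition embed_x :: "('m::finite, 'k::comm_ring_1) mpoly \<Rightarrow> ('m + 'n::finite, 'k) mpoly" where
  "embed_x = mpoly_hom mpoly_const (\<lambda>i. mpoly_var (Inl i))"

definition embed_y :: "('n::finite, 'k::comm_ring_1) mpoly \<Rightarrow> ('m::finite + 'n, 'k) mpoly" where
  "embed_y = mpoly_hom mpoly_const (\<lambda>j. mpoly_var (Inr j))"

definition eval_y :: "('n::finite \<Rightarrow> 'k::comm_ring_1) \<Rightarrow> ('m::finite + 'n, 'k) mpoly \<Rightarrow> ('m, 'k) mpoly" where
  "eval_y w = mpoly_hom mpoly_const (case_sum mpoly_var (\<lambda>j. mpoly_const (w j)))"

lemma type_ring_hom_embed: "type_ring_hom embed_x" "type_ring_hom embed_y" "type_ring_hom (eval_y w)"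
  unfolding embed_x_def embed_y_def eval_y_def
  by (intro type_ring_hom.type_ring_hom_mpoly_hom[OF type_ring_hom_const])+

lemma embed_simps [simp]:
  "embed_x (mpoly_const a) = mpoly_const a" "embed_x (mpoly_var i) = mpoly_var (Inl i)"
  "embed_y (mpoly_const a) = mpoly_const a" "embed_y (mpoly_var j) = mpoly_var (Inr j)"
  "eval_y w (mpoly_const a) = mpoly_const a" "eval_y w (mpoly_var (Inl i)) = mpoly_var i"
  "eval_y w (mpoly_var (Inr j)) = mpoly_const (w j)"
  unfolding embed_x_def embed_y_def eval_y_def
  by (simp_all add: type_ring_hom.mpoly_hom_const[OF type_ring_hom_const]
      type_ring_hom.mpoly_hom_var[OF type_ring_hom_const])

lemma eval_y_embed_x [simp]: "eval_y w (embed_x e) = e"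
  by (rule mpoly_hom_unique[of "\<lambda>e. eval_y w (embed_x e)" "\<lambda>e. e"])
    (simp_all add: type_ring_hom_comp[OF type_ring_hom_embed(3,1)] type_ring_hom_id)

lemma eval_y_embed_y [simp]: "eval_y w (embed_y h) = mpoly_const (mpoly_eval w h)"
  by (rule mpoly_hom_unique[of "\<lambda>h. eval_y w (embed_y h)" "\<lambda>h. mpoly_const (mpoly_eval w h)"])
    (simp_all add: type_ring_hom_comp[OF type_ring_hom_embed(3,2)]
      type_ring_hom_comp[OF type_ring_hom_const type_ring_hom_mpoly_eval])

lemma mpoly_eval_eval_y: "mpoly_eval v (eval_y w f) = mpoly_eval (case_sum v w) f"
proof (rule mpoly_hom_unique[of "\<lambda>f. mpoly_eval v (eval_y w f)"])
  show "type_ring_hom (\<lambda>f. mpoly_eval v (eval_y w f))"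
    by (rule type_ring_hom_comp[OF type_ring_hom_mpoly_eval type_ring_hom_embed(3)])
  show "mpoly_eval v (eval_y w (mpoly_var i)) = mpoly_eval (case_sum v w) (mpoly_var i)" for i
    by (cases i) simp_all
qed (simp_all add: type_ring_hom_mpoly_eval)

lemma mpoly_eval_embed [simp]:
  "mpoly_eval (case_sum v w) (embed_x e) = mpoly_eval v e"
  "mpoly_eval (case_sum v w) (embed_y h) = mpoly_eval w h"
  by (simp_all flip: mpoly_eval_eval_y)

text \<open>For an ideal \<open>A\<close> of \<open>k[x]\<close> this is its extension to
  \<open>k[x, y]\<close>, the tensor product of \<open>A\<close> with \<open>k[y]\<close> over
  \<open>k\<close>. Adding one term at a time provides induction on the number of terms.\<close>

inductive_set x_span ::
  "('m::finite, 'k::comm_ring_1) mpoly set \<Rightarrow> ('m + 'n::finite, 'k) mpoly set" for A where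
  zero: "0 \<in> x_span A"
| term_add: "e \<in> A \<Longrightarrow> g \<in> x_span A \<Longrightarrow> embed_x e * embed_y h + g \<in> x_span A"

lemma x_span_add: "f \<in> x_span A \<Longrightarrow> g \<in> x_span A \<Longrightarrow> f + g \<in> x_span A"
  by (induction f rule: x_span.induct) (auto simp: add.assoc intro: x_span.term_add)

lemma x_span_term: "e \<in> A \<Longrightarrow> embed_x e * embed_y h \<in> x_span A"
  using x_span.term_add[OF _ x_span.zero] by fastforce

lemma x_span_mult_embed_y: "g \<in> x_span A \<Longrightarrow> embed_y q * g \<in> x_span A"
proof (induction g rule: x_span.induct)
  case (term_add e g h)
  interpret type_ring_hom embed_y by (rule type_ring_hom_embed)
  have "embed_y q * (embed_x e * embed_y h + g) = embed_x e * embed_y (q * h) + embed_y q * g"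
    by (simp add: hom_mult algebra_simps)
  then show ?case using term_add by (auto intro: x_span.term_add)
qed (simp add: x_span.zero)

lemma x_span_UNIV: "f \<in> x_span UNIV"
proof -
  interpret x: type_ring_hom embed_x by (rule type_ring_hom_embed)
  interpret y: type_ring_hom embed_y by (rule type_ring_hom_embed)
  have mult_x: "embed_x e * g \<in> x_span UNIV" if "g \<in> x_span UNIV" for e g
    using that
  proof (induction g rule: x_span.induct)
    case (term_add e' g h)
    have "embed_x e * (embed_x e' * embed_y h + g) = embed_x (e * e') * embed_y h + embed_x e * g"
      by (simp add: x.hom_mult algebra_simps)
    then show ?case using term_add by (auto intro: x_span.term_add)
  qed (simp add: x_span.zero)
  have mult: "f * g \<in> x_span UNIV" if "f \<in> x_span UNIV" "g \<in> x_span UNIV" for f g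
    using that(1)
  proof (induction f rule: x_span.induct)
    case (term_add e f h)
    have "(embed_x e * embed_y h + f) * g = embed_x e * (embed_y h * g) + f * g"
      by (simp add: algebra_simps)
    then show ?case using term_add that(2) by (auto intro: x_span_add mult_x x_span_mult_embed_y)
  qed (simp add: x_span.zero)
  show ?thesis
  proof (induction f rule: mpoly_induct)
    case (const a)
    then show ?case
      using x_span_term[of "mpoly_const a" UNIV 1] by (simp add: y.hom_one)
  next
    case (var i)
    show ?case
    proof (cases i)
      case (Inl a)
      then show ?thesis using x_span_term[of "mpoly_var a" UNIV 1] by (simp add: y.hom_one)
    next
      case (Inr b)
      then show ?thesis using x_span_term[of 1 UNIV "mpoly_var b"] by (simp add: x.hom_one)
    qed
  qed (auto intro: x_span_add mult)
qed

lemma eval_y_x_span: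
  assumes "type_ideal A" "g \<in> x_span A"
  shows "eval_y w g \<in> A"
proof -
  interpret type_ring_hom "eval_y w" by (rule type_ring_hom_embed)
  show ?thesis
    using assms(2)
    by (induction g rule: x_span.induct)
      (auto simp: hom_zero hom_add hom_mult type_ideal_zero[OF assms(1)]
        intro: type_ideal_add[OF assms(1)] type_ideal_mult_right[OF assms(1)])
qed

text \<open>Indexing by natural numbers permits repeated coefficients \<open>e i\<close> and leaves
  a fresh index for every further term.\<close>

lemma x_span_sum_repr:
  assumes "g \<in> x_span A"
  shows "\<exists>I e h. finite (I :: nat set) \<and> (\<forall>i\<in>I. e i \<in> A) \<and> g = (\<Sum>i\<in>I. embed_x (e i) * embed_y (h i))"
  using assms
proof (induction g rule: x_span.induct)
  case zero
  then show ?case by (intro exI[of _ "{}"]) auto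
next
  case (term_add e0 g h0)
  then obtain I e h where I: "finite (I :: nat set)" "\<forall>i\<in>I. e i \<in> A"
    "g = (\<Sum>i\<in>I. embed_x (e i) * embed_y (h i))" by blast
  obtain n where n: "n \<notin> I" using I(1) ex_new_if_finite[OF infinite_UNIV_nat] by blast
  have "(\<Sum>i\<in>I. embed_x ((e(n := e0)) i) * embed_y ((h(n := h0)) i)) =
      (\<Sum>i\<in>I. embed_x (e i) * embed_y (h i))"
    by (rule sum.cong) (use n in auto)
  then show ?case
    using I n term_add(1)
    by (intro exI[of _ "insert n I"] exI[of _ "e(n := e0)"] exI[of _ "h(n := h0)"]) auto
qed

text \<open>A representation modulo \<open>A'\<close> with the least number of terms is independent: a linear
  relation between the \<open>e i\<close> would allow one of them to be eliminated.\<close>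

lemma x_span_independent_repr:
  fixes g :: "('m::finite + 'n::finite, 'k::field) mpoly"
  assumes "g \<in> x_span A" and A: "type_ideal A" and A': "type_ideal A'"
  shows "\<exists>I e h. finite (I :: nat set) \<and> (\<forall>i\<in>I. e i \<in> A) \<and>
    g - (\<Sum>i\<in>I. embed_x (e i) * embed_y (h i)) \<in> x_span A' \<and>
    (\<forall>c. (\<Sum>i\<in>I. mpoly_const (c i) * e i) \<in> A' \<longrightarrow> (\<forall>i\<in>I. c i = 0))"
proof -
  interpret x: type_ring_hom "embed_x :: _ \<Rightarrow> ('m + 'n, 'k) mpoly" by (rule type_ring_hom_embed)
  interpret y: type_ring_hom "embed_y :: _ \<Rightarrow> ('m + 'n, 'k) mpoly" by (rule type_ring_hom_embed)
  interpret c: type_ring_hom "mpoly_const :: 'k \<Rightarrow> ('m, 'k) mpoly" by (rule type_ring_hom_const)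
  define R where "R = (\<lambda>I e h. finite (I :: nat set) \<and> (\<forall>i\<in>I. e i \<in> A) \<and>
    g - (\<Sum>i\<in>I. embed_x (e i) * embed_y (h i)) \<in> x_span A')"
  have "\<exists>I e h. R I e h"
  proof -
    obtain I e h where "finite (I :: nat set)" "\<forall>i\<in>I. e i \<in> A"
      "g = (\<Sum>i\<in>I. embed_x (e i) * embed_y (h i))"
      using x_span_sum_repr[OF assms(1)] by blast
    then have "R I e h" unfolding R_def by (simp add: x_span.zero)
    then show ?thesis by blast
  qed
  then obtain I e h where R: "R I e h" and min: "\<And>J e' h'. R J e' h' \<Longrightarrow> card I \<le> card J"
    using ex_has_least_nat[of "\<lambda>I. \<exists>e h. R I e h" _ card] by blast
  have "c i0 = 0" if rel: "(\<Sum>i\<in>I. mpoly_const (c i) * e i) \<in> A'" and i0: "i0 \<in> I" for c i0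
  proof (rule ccontr)
    assume nz: "c i0 \<noteq> 0"
    define d where "d = (\<lambda>i. c i / c i0)"
    define a where "a = mpoly_const (inverse (c i0)) * (\<Sum>i\<in>I. mpoly_const (c i) * e i)"
    have a: "a \<in> A'" unfolding a_def by (rule type_ideal_mult_left[OF A' rel])
    have "a = (\<Sum>i\<in>I. mpoly_const (d i) * e i)"
      unfolding a_def d_def sum_distrib_left
      by (intro sum.cong refl) (simp add: field_simps flip: mult.assoc c.hom_mult)
    also have "\<dots> = e i0 + (\<Sum>i\<in>I-{i0}. mpoly_const (d i) * e i)"
      using R i0 nz by (subst sum.remove[of I i0]) (auto simp: R_def d_def c.hom_one)
    finally have e0: "e i0 = a - (\<Sum>i\<in>I-{i0}. mpoly_const (d i) * e i)" by simp
    \<comment> \<open>Replacing \<open>e i0\<close> by \<open>a\<close> minus the other terms shifts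
      \<open>d i * h i0\<close> onto each remaining \<open>y\<close>-coefficient; what is left with
      \<open>a\<close> lies in \<open>x_span A'\<close>.\<close>
    define h' where "h' = (\<lambda>i. h i - mpoly_const (d i) * h i0)"
    have "(\<Sum>i\<in>I. embed_x (e i) * embed_y (h i)) =
        embed_x (e i0) * embed_y (h i0) + (\<Sum>i\<in>I-{i0}. embed_x (e i) * embed_y (h i))"
      using R i0 by (subst sum.remove[of I i0]) (auto simp: R_def)
    also have "\<dots> = embed_x a * embed_y (h i0) + (\<Sum>i\<in>I-{i0}. embed_x (e i) * embed_y (h' i))"
      unfolding e0 h'_def
      by (simp add: x.hom_diff y.hom_diff x.hom_sum x.hom_mult y.hom_mult left_diff_distrib
          right_diff_distrib sum_subtractf sum_distrib_left mult_ac)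
    finally have "g - (\<Sum>i\<in>I-{i0}. embed_x (e i) * embed_y (h' i)) =
        embed_x a * embed_y (h i0) + (g - (\<Sum>i\<in>I. embed_x (e i) * embed_y (h i)))" by simp
    also have "\<dots> \<in> x_span A'"
      using a R by (auto simp: R_def intro: x_span.term_add)
    finally have "R (I - {i0}) e h'"
      using R by (auto simp: R_def)
    then have "card I \<le> card (I - {i0})" by (rule min)
    moreover have "card (I - {i0}) < card I"
      using R i0 by (intro psubset_card_mono) (auto simp: R_def)
    ultimately show False by simp
  qed
  then show ?thesis using R unfolding R_def by blast
qed

definition ideal_adjoin :: "'a::comm_ring_1 set \<Rightarrow> 'a \<Rightarrow> 'a set" where
  "ideal_adjoin I p = {p * r + i |r i. i \<in> I}"

lemma type_ideal_ideal_adjoin: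
  assumes "type_ideal I"
  shows "type_ideal (ideal_adjoin I p)"
  unfolding type_ideal_def
proof (intro conjI ballI allI)
  show "0 \<in> ideal_adjoin I p"
    unfolding ideal_adjoin_def using type_ideal_zero[OF assms] by (intro CollectI exI[of _ 0]) simp
next
  fix a b assume "a \<in> ideal_adjoin I p" "b \<in> ideal_adjoin I p"
  then obtain r i s j where "a = p * r + i" "b = p * s + j" "i \<in> I" "j \<in> I"
    by (auto simp: ideal_adjoin_def)
  then show "a + b \<in> ideal_adjoin I p"
    unfolding ideal_adjoin_def using type_ideal_add[OF assms]
    by (intro CollectI exI[of _ "r + s"] exI[of _ "i + j"]) (simp add: algebra_simps)
next
  fix t a assume "a \<in> ideal_adjoin I p"
  then obtain r i where "a = p * r + i" "i \<in> I" by (auto simp: ideal_adjoin_def)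
  then show "t * a \<in> ideal_adjoin I p"
    unfolding ideal_adjoin_def using type_ideal_mult_left[OF assms]
    by (intro CollectI exI[of _ "t * r"] exI[of _ "t * i"]) (simp add: algebra_simps)
qed

lemma subset_ideal_adjoin: "I \<subseteq> ideal_adjoin I p"
proof
  fix i assume "i \<in> I"
  then show "i \<in> ideal_adjoin I p"
    unfolding ideal_adjoin_def by (intro CollectI exI[of _ 0] exI[of _ i]) simp
qed

lemma mult_in_ideal_adjoin: "type_ideal I \<Longrightarrow> p * r \<in> ideal_adjoin I p"
  unfolding ideal_adjoin_def by (intro CollectI exI[of _ r] exI[of _ 0]) (simp add: type_ideal_zero)

section \<open>The regular sequence\<close>

definition cone_ideal :: "('v::finite \<Rightarrow> 'k::field) set set \<Rightarrow> ('v, 'k) mpoly set" where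
  "cone_ideal U = {f. \<forall>P\<in>U. \<forall>v\<in>P. mpoly_eval v f = 0}"

lemma type_ideal_cone_ideal: "type_ideal (cone_ideal U)"
  unfolding type_ideal_def cone_ideal_def
  by (simp add: type_ring_hom.hom_zero[OF type_ring_hom_mpoly_eval]
      type_ring_hom.hom_add[OF type_ring_hom_mpoly_eval] type_ring_hom.hom_mult[OF type_ring_hom_mpoly_eval])

text \<open>The fibres over the points of the first factor are peeled off from the largest to the
  smallest. Once the fibres over \<open>U\<close> are dealt with, the remainder has its \<open>x\<close>-coefficients in
  \<open>cone_ideal U + (p)\<close>; in an independent representation of it modulo the corresponding ideal
  of the next stage, evaluation at the points of the next fibre separates the \<open>y\<close>-coefficients.\<close>

lemma regular_modulo_of_chain:
  fixes Z :: "(('m::finite \<Rightarrow> 'k::field) set \<times> ('n::finite \<Rightarrow> 'k) set) set"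
  assumes "finite Z"
    and chain: "\<And>P P'. Z `` {P} \<subseteq> Z `` {P'} \<or> Z `` {P'} \<subseteq> Z `` {P}"
    and q: "\<And>P Q h. (P, Q) \<in> Z \<Longrightarrow> \<forall>w\<in>Q. mpoly_eval w (q * h) = 0 \<Longrightarrow> \<forall>w\<in>Q. mpoly_eval w h = 0"
    and g: "embed_y q * g \<in> ideal_adjoin (vanishing_ideal Z) (embed_x p)"
  shows "g \<in> ideal_adjoin (vanishing_ideal Z) (embed_x p)"
proof -
  define W where "W = ideal_adjoin (vanishing_ideal Z) (embed_x p)"
  have W: "type_ideal W"
    unfolding W_def by (intro type_ideal_ideal_adjoin type_ideal_vanishing_ideal)
  define \<aa> where "\<aa> = (\<lambda>U. ideal_adjoin (cone_ideal U) p)"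
  have \<aa>: "type_ideal (\<aa> U)" for U
    unfolding \<aa>_def by (intro type_ideal_ideal_adjoin type_ideal_cone_ideal)
  interpret x: type_ring_hom "embed_x :: _ \<Rightarrow> ('m + 'n, 'k) mpoly" by (rule type_ring_hom_embed)
  interpret y: type_ring_hom "embed_y :: _ \<Rightarrow> ('m + 'n, 'k) mpoly" by (rule type_ring_hom_embed)
  define PP where "PP = fst ` Z"
  have fin: "finite PP" using assms(1) by (simp add: PP_def)
  \<comment> \<open>Invariant of the peeling: the fibres already removed contain all those that
    remain.\<close>
  define closed where "closed = (\<lambda>U. U \<subseteq> PP \<and> (\<forall>P\<in>U. \<forall>P'\<in>PP - U. Z `` {P'} \<subseteq> Z `` {P}))"
  \<comment> \<open>Up to a multiple of \<open>p\<close>, the factor \<open>e\<close> vanishes at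
    the points over \<open>U\<close>, while \<open>h\<close> takes care of all other points.\<close>
  have term_in: "embed_x e * embed_y h \<in> W"
    if e: "e \<in> \<aa> U" and van: "\<And>P Q w. (P, Q) \<in> Z \<Longrightarrow> P \<notin> U \<Longrightarrow> w \<in> Q \<Longrightarrow> mpoly_eval w h = 0" for e h U
  proof -
    obtain r u where ru: "e = p * r + u" "u \<in> cone_ideal U"
      using e by (auto simp: \<aa>_def ideal_adjoin_def)
    have "embed_x u * embed_y h \<in> vanishing_ideal Z"
      unfolding vanishing_ideal_def
    proof (intro CollectI ballI, clarify)
      fix P Q v w assume *: "(P, Q) \<in> Z" "v \<in> P" "w \<in> Q"
      then have "mpoly_eval v u = 0 \<or> mpoly_eval w h = 0"
        using van ru(2) by (cases "P \<in> U") (auto simp: cone_ideal_def)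
      then show "mpoly_eval (case_sum v w) (embed_x u * embed_y h) = 0"
        by (auto simp: type_ring_hom.hom_mult[OF type_ring_hom_mpoly_eval])
    qed
    moreover have "embed_x e * embed_y h = embed_x p * (embed_x r * embed_y h) + embed_x u * embed_y h"
      unfolding ru(1) by (simp add: x.hom_add x.hom_mult algebra_simps)
    ultimately show ?thesis unfolding W_def ideal_adjoin_def by blast
  qed
  have step: "\<exists>g'\<in>x_span (\<aa> (insert P' U)). g - g' \<in> W"
    if cl: "closed U" and P': "P' \<in> PP - U" and max: "\<And>P. P \<in> PP - U \<Longrightarrow> Z `` {P} \<subseteq> Z `` {P'}"
      and g1: "g1 \<in> x_span (\<aa> U)" "g - g1 \<in> W" for U P' g1
  proof -
    obtain I e h where I: "finite (I :: nat set)" "\<And>i. i \<in> I \<Longrightarrow> e i \<in> \<aa> U"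
      and r: "g1 - (\<Sum>i\<in>I. embed_x (e i) * embed_y (h i)) \<in> x_span (\<aa> (insert P' U))"
      and indep: "\<And>c i. (\<Sum>i\<in>I. mpoly_const (c i) * e i) \<in> \<aa> (insert P' U) \<Longrightarrow> i \<in> I \<Longrightarrow> c i = 0"
      using x_span_independent_repr[OF g1(1) \<aa> \<aa>[of "insert P' U"]] by blast
    define r where "r = g1 - (\<Sum>i\<in>I. embed_x (e i) * embed_y (h i))"
    have rx: "r \<in> x_span (\<aa> (insert P' U))" using r by (simp add: r_def)
    have "embed_y q * g1 = embed_y q * g - embed_y q * (g - g1)" by (simp add: algebra_simps)
    then have qg1: "embed_y q * g1 \<in> W"
      using g g1(2) by (simp add: W_def[symmetric] type_ideal_diff[OF W] type_ideal_mult_left[OF W])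
    have qh: "mpoly_eval w (q * h i) = 0" if Q: "(P', Q) \<in> Z" "w \<in> Q" and i: "i \<in> I" for Q w i
    proof -
      interpret e: type_ring_hom "eval_y w :: ('m + 'n, 'k) mpoly \<Rightarrow> _" by (rule type_ring_hom_embed)
      obtain s j where sj: "embed_y q * g1 = embed_x p * s + j" "j \<in> vanishing_ideal Z"
        using qg1 by (auto simp: W_def ideal_adjoin_def)
      \<comment> \<open>All fibres over \<open>insert P' U\<close> contain \<open>Q\<close>, so
        fixing \<open>y = w\<close> still leaves a polynomial vanishing at every point of
        \<open>insert P' U\<close>.\<close>
      have "eval_y w j \<in> cone_ideal (insert P' U)"
        unfolding cone_ideal_def
      proof (intro CollectI ballI)
        fix P v assume P: "P \<in> insert P' U" "v \<in> P"
        then have "Z `` {P'} \<subseteq> Z `` {P}" using cl P' by (auto simp: closed_def)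
        then have "(P, Q) \<in> Z" using Q by auto
        then show "mpoly_eval v (eval_y w j) = 0"
          using sj(2) P Q by (auto simp: vanishing_ideal_def mpoly_eval_eval_y)
      qed
      then have "eval_y w (embed_y q * g1) \<in> \<aa> (insert P' U)"
        unfolding sj(1) \<aa>_def ideal_adjoin_def by (auto simp: e.hom_add e.hom_mult)
      moreover have "eval_y w (embed_y q * r) \<in> \<aa> (insert P' U)"
        by (intro eval_y_x_span \<aa> x_span_mult_embed_y rx)
      ultimately have "eval_y w (embed_y q * g1) - eval_y w (embed_y q * r) \<in> \<aa> (insert P' U)"
        by (rule type_ideal_diff[OF \<aa>])
      also have "eval_y w (embed_y q * g1) - eval_y w (embed_y q * r) =
          eval_y w (embed_y q * (\<Sum>i\<in>I. embed_x (e i) * embed_y (h i)))"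
        unfolding r_def by (simp add: algebra_simps flip: e.hom_diff)
      also have "\<dots> = (\<Sum>i\<in>I. mpoly_const (mpoly_eval w (q * h i)) * e i)"
        by (simp add: e.hom_mult e.hom_sum sum_distrib_left mult_ac
            type_ring_hom.hom_mult[OF type_ring_hom_mpoly_eval] type_ring_hom.hom_mult[OF type_ring_hom_const])
      finally show ?thesis using indep[of "\<lambda>i. mpoly_eval w (q * h i)"] i by blast
    qed
    \<comment> \<open>The remaining fibres lie inside the one over \<open>P'\<close>, where
      regularity of \<open>q\<close> has removed the factor \<open>q\<close>.\<close>
    have h: "mpoly_eval w (h i) = 0" if i: "i \<in> I" and "(P, Q) \<in> Z" "P \<notin> U" "w \<in> Q" for P Q w i
    proof -
      have "P \<in> PP - U" using that by (force simp: PP_def)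
      then have "(P', Q) \<in> Z" using max that by blast
      then show ?thesis using q[of P' Q "h i"] qh i that by blast
    qed
    have "(\<Sum>i\<in>I. embed_x (e i) * embed_y (h i)) \<in> W"
      by (intro type_ideal_sum[OF W] term_in[OF I(2)] h)
    then have "(g - g1) + (\<Sum>i\<in>I. embed_x (e i) * embed_y (h i)) \<in> W"
      using g1(2) type_ideal_add[OF W] by blast
    then have "g - r \<in> W" by (simp add: r_def algebra_simps)
    then show ?thesis using rx by blast
  qed
  have "\<exists>g'\<in>x_span (\<aa> PP). g - g' \<in> W" if "closed U" "g1 \<in> x_span (\<aa> U)" "g - g1 \<in> W" for U g1
    using that
  proof (induction "card (PP - U)" arbitrary: U g1)
    case 0
    then have "U = PP" using fin by (auto simp: closed_def)
    then show ?case using 0 by blast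
  next
    case (Suc n)
    have "card (PP - U) \<noteq> 0" using Suc.hyps(2) by simp
    then have "finite (PP - U)" "PP - U \<noteq> {}" unfolding card_eq_0_iff by blast+
    then obtain P' where P': "P' \<in> PP - U"
      and P'_max: "\<And>P. P \<in> PP - U \<Longrightarrow> Z `` {P'} \<subseteq> Z `` {P} \<Longrightarrow> Z `` {P'} = Z `` {P}"
      using finite_has_maximal[of "(\<lambda>P. Z `` {P}) ` (PP - U)"] by blast
    \<comment> \<open>A maximal fibre is the largest one because any two are comparable.\<close>
    have max: "Z `` {P} \<subseteq> Z `` {P'}" if "P \<in> PP - U" for P
      using P'_max[OF that] chain[of P P'] by blast
    obtain g' where g': "g' \<in> x_span (\<aa> (insert P' U))" "g - g' \<in> W"
      using step[OF Suc.prems(1) P' max Suc.prems(2,3)] by blast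
    have "n = card (PP - insert P' U)"
      using Suc.hyps(2) P' fin by (subst Diff_insert) simp
    moreover have "closed (insert P' U)"
      using Suc.prems(1) P' max by (auto simp: closed_def)
    ultimately show ?case using Suc.hyps(1) g' by blast
  qed
  moreover have "closed {}" by (simp add: closed_def)
  \<comment> \<open>Before any fibre is removed, \<open>cone_ideal {}\<close> is the whole ring, so
    every \<open>g\<close> qualifies.\<close>
  moreover have "g \<in> x_span (\<aa> {})"
    using x_span_UNIV[of g] subset_ideal_adjoin[of "cone_ideal {}" p]
    by (simp add: \<aa>_def cone_ideal_def top.extremum_unique)
  ultimately obtain g' where g': "g' \<in> x_span (\<aa> PP)" "g - g' \<in> W"
    using type_ideal_zero[OF W] by (metis diff_self)
  \<comment> \<open>At the last stage no points remain at which the \<open>y\<close>-coefficients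
    would have to vanish.\<close>
  have "g' \<in> W"
    using g'(1)
  proof (induction g' rule: x_span.induct)
    case (term_add e g h)
    have "embed_x e * embed_y h \<in> W"
      by (rule term_in[OF term_add(1)]) (force simp: PP_def)
    then show ?case using term_add type_ideal_add[OF W] by blast
  qed (rule type_ideal_zero[OF W])
  then have "g \<in> W" using g'(2) type_ideal_add[OF W, of "g - g'" g'] by simp
  then show ?thesis by (simp add: W_def)
qed

text \<open>Along a line the polynomial becomes univariate with infinitely many roots. This cancels
  a factor that is nonzero off finitely many parameters; the base point \<open>b\<close> holds the
  other group of variables fixed.\<close>

lemma mpoly_eval_affine_line:
  fixes b u :: "'v::finite \<Rightarrow> 'k::field_char_0"
  assumes "finite B" "\<And>c. c \<notin> B \<Longrightarrow> mpoly_eval (\<lambda>i. b i + c * u i) f = 0"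
  shows "mpoly_eval (\<lambda>i. b i + c * u i) f = 0"
proof -
  define F where "F = mpoly_hom (\<lambda>a. [:a:]) (\<lambda>i. [:b i, u i:]) f"
  have F: "poly F c = mpoly_eval (\<lambda>i. b i + c * u i) f" for c
    unfolding F_def
    by (rule mpoly_hom_unique[of "\<lambda>f. poly (mpoly_hom (\<lambda>a. [:a:]) (\<lambda>i. [:b i, u i:]) f) c"])
      (simp_all add: type_ring_hom_comp[OF type_ring_hom_poly type_ring_hom.type_ring_hom_mpoly_hom[OF type_ring_hom_const_poly]]
        type_ring_hom_mpoly_eval type_ring_hom.mpoly_hom_const[OF type_ring_hom_const_poly]
        type_ring_hom.mpoly_hom_var[OF type_ring_hom_const_poly])
  have "F = 0"
  proof (rule ccontr)
    assume "F \<noteq> 0"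
    then have "finite {c. poly F c = 0}" by (rule poly_roots_finite)
    moreover have "UNIV = B \<union> {c. poly F c = 0}" using assms(2) F by auto
    ultimately show False using assms(1) infinite_UNIV_char_0 by (metis finite_Un)
  qed
  then show ?thesis using F[of c] by simp
qed

text \<open>Coefficients are taken on a moment curve, \<open>a i = c ^ idx i\<close>. The value at
  \<open>v\<close> is then a nonzero polynomial in \<open>c\<close> with coefficients
  \<open>v i\<close>, and only finitely many \<open>c\<close> have to be avoided.\<close>

lemma generic_linear_form:
  fixes V :: "('v::finite \<Rightarrow> 'k::field_char_0) set"
  assumes "finite V" "\<And>v. v \<in> V \<Longrightarrow> v \<noteq> (\<lambda>_. 0)"
  shows "\<exists>a. \<forall>v\<in>V. (\<Sum>i\<in>UNIV. a i * v i) \<noteq> 0"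
proof -
  obtain idx :: "'v \<Rightarrow> nat" where idx: "inj idx"
    using finite_imp_inj_to_nat_seg[OF finite_UNIV] by auto
  define F where "F = (\<lambda>v::'v \<Rightarrow> 'k. \<Sum>i\<in>UNIV. monom (v i) (idx i))"
  have "F v \<noteq> 0" if "v \<in> V" for v
  proof -
    obtain j where j: "v j \<noteq> 0" using assms(2)[OF \<open>v \<in> V\<close>] by auto
    have "coeff (F v) (idx j) = (\<Sum>i\<in>UNIV. if i = j then v i else 0)"
      unfolding F_def coeff_sum by (rule sum.cong) (use idx in \<open>auto simp: inj_eq\<close>)
    then show ?thesis using j by auto
  qed
  then have "finite (\<Union>v\<in>V. {c. poly (F v) c = 0})"
    using assms(1) by (intro finite_UN_I poly_roots_finite) auto
  then obtain c where c: "c \<notin> (\<Union>v\<in>V. {c. poly (F v) c = 0})"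
    using ex_new_if_finite[OF infinite_UNIV_char_0] by blast
  have "poly (F v) c = (\<Sum>i\<in>UNIV. c ^ idx i * v i)" for v
    by (simp add: F_def poly_sum poly_monom mult.commute)
  then show ?thesis using c by (intro exI[of _ "\<lambda>i. c ^ idx i"]) auto
qed

text \<open>The witness is \<open>r(L)\<close> for a generic linear form \<open>L\<close> with value
  1 at \<open>v\<close>. On every other line \<open>L\<close> is a nonzero multiple of the
  parameter, so \<open>r(L)\<close> has only finitely many zeros there.\<close>

lemma univariate_on_lines:
  fixes r :: "'k::field_char_0 poly" and V :: "('v::finite \<Rightarrow> 'k) set"
  assumes "r \<noteq> 0" "finite V" "\<And>v. v \<in> V \<Longrightarrow> v \<noteq> (\<lambda>_. 0)" "v \<in> V"
  shows "\<exists>p. (\<forall>c. mpoly_eval (\<lambda>i. c * v i) p = poly r c) \<and>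
    (\<forall>u\<in>V. finite {c. mpoly_eval (\<lambda>i. c * u i) p = 0})"
proof -
  obtain a where a: "\<And>u. u \<in> V \<Longrightarrow> (\<Sum>i\<in>UNIV. a i * u i) \<noteq> 0"
    using generic_linear_form[OF assms(2,3)] by blast
  define l where "l = (\<lambda>u. (\<Sum>i\<in>UNIV. a i * u i) / (\<Sum>i\<in>UNIV. a i * v i))"
  define L where "L = mpoly_const (inverse (\<Sum>i\<in>UNIV. a i * v i)) * (\<Sum>i\<in>UNIV. mpoly_const (a i) * mpoly_var i)"
  have L: "mpoly_eval (\<lambda>i. c * u i) L = c * l u" for u c
  proof -
    interpret type_ring_hom "mpoly_eval (\<lambda>i. c * u i)" by (rule type_ring_hom_mpoly_eval)
    show ?thesis
      by (simp add: L_def hom_mult hom_sum l_def field_simps sum_distrib_left)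
  qed
  define p where "p = poly (map_poly mpoly_const r) L"
  have p: "mpoly_eval u p = poly r (mpoly_eval u L)" for u
  proof -
    interpret type_ring_hom "mpoly_eval u" by (rule type_ring_hom_mpoly_eval)
    have "mpoly_const 0 = (0 :: ('v, 'k) mpoly)"
      by (rule type_ring_hom.hom_zero[OF type_ring_hom_const])
    then show ?thesis unfolding p_def
      by (induction r) (simp_all add: hom_zero map_poly_pCons hom_add hom_mult)
  qed
  have "finite {c. mpoly_eval (\<lambda>i. c * u i) p = 0}" if "u \<in> V" for u
  proof -
    have "l u \<noteq> 0" using a[OF that] a[OF assms(4)] by (simp add: l_def)
    then have "inj_on (\<lambda>c. c * l u) {c. mpoly_eval (\<lambda>i. c * u i) p = 0}" by (simp add: inj_on_def)
    moreover have "(\<lambda>c. c * l u) ` {c. mpoly_eval (\<lambda>i. c * u i) p = 0} \<subseteq> {c. poly r c = 0}"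
      by (auto simp: p L)
    ultimately show ?thesis
      using poly_roots_finite[OF assms(1)] finite_subset finite_imageD by blast
  qed
  moreover have "l v = 1" using a[OF assms(4)] by (simp add: l_def)
  ultimately show ?thesis by (intro exI[of _ p]) (auto simp: p L)
qed

section \<open>Maximal ideals over the ideal of a set of points\<close>

definition type_primeideal :: "'a::comm_ring_1 set \<Rightarrow> bool" where
  "type_primeideal J \<longleftrightarrow> type_ideal J \<and> 1 \<notin> J \<and> (\<forall>f g. f * g \<in> J \<longrightarrow> f \<in> J \<or> g \<in> J)"

text \<open>Maximality in the form that the quotient is a field, so that elements outside
  \<open>J\<close> can be inverted modulo \<open>J\<close>.\<close>

definition type_maximalideal :: "'a::comm_ring_1 set \<Rightarrow> bool" where
  "type_maximalideal J \<longleftrightarrow> type_ideal J \<and> 1 \<notin> J \<and> (\<forall>f. f \<notin> J \<longrightarrow> (\<exists>g. f * g - 1 \<in> J))"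

lemma type_maximalideal_prime:
  assumes "type_maximalideal J"
  shows "type_primeideal J"
proof -
  have J: "type_ideal J" using assms by (simp add: type_maximalideal_def)
  have "g \<in> J" if fg: "f * g \<in> J" and f: "f \<notin> J" for f g
  proof -
    obtain f' where f': "f * f' - 1 \<in> J" using assms f by (auto simp: type_maximalideal_def)
    have "g = f' * (f * g) - g * (f * f' - 1)" by (simp add: algebra_simps)
    also have "\<dots> \<in> J" by (intro type_ideal_diff[OF J] type_ideal_mult_left[OF J] fg f')
    finally show ?thesis .
  qed
  then show ?thesis using assms by (auto simp: type_primeideal_def type_maximalideal_def)
qed

lemma type_primeideal_prod:
  assumes "type_primeideal J" "finite A" "prod f A \<in> J"
  shows "\<exists>i\<in>A. f i \<in> J"
  using assms(2,3) by (induction A) (use assms(1) in \<open>auto simp: type_primeideal_def\<close>)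

text \<open>Containing the kernel of a surjection onto \<open>k[s, t]\<close>, \<open>M\<close> is
  the preimage of a maximal ideal there, and that ideal contains a prime \<open>r(s)\<close>. The
  condition on \<open>f\<close> says, through values, that \<open>f\<close> restricts to
  \<open>r(s)\<close>.\<close>

lemma maximal_ideal_over_plane_x:
  fixes v :: "'m::finite \<Rightarrow> 'k::field_char_0" and w :: "'n::finite \<Rightarrow> 'k"
  assumes M: "type_maximalideal M" and vw: "v \<noteq> (\<lambda>_. 0)" "w \<noteq> (\<lambda>_. 0)"
    and ker: "{f. restrict_plane v w f = 0} \<subseteq> M"
  shows "\<exists>r. prime_elem r \<and>
    (\<forall>f. (\<forall>c d. mpoly_eval (case_sum (\<lambda>i. c * v i) (\<lambda>j. d * w j)) f = poly r c) \<longrightarrow> f \<in> M)"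
proof -
  interpret type_ring_hom "restrict_plane v w" by (rule type_ring_hom_restrict_plane)
  have surj: "surj (restrict_plane v w)" by (rule surj_restrict_plane[OF vw])
  have MI: "type_ideal M" using M by (simp add: type_maximalideal_def)
  have mem: "restrict_plane v w f \<in> restrict_plane v w ` M \<longleftrightarrow> f \<in> M" for f
  proof
    assume "restrict_plane v w f \<in> restrict_plane v w ` M"
    then obtain g where g: "g \<in> M" "restrict_plane v w (f - g) = 0" by (auto simp: hom_diff)
    then show "f \<in> M" using ker type_ideal_diff_cong[OF MI, of f g] by auto
  qed simp
  have m: "type_ideal (restrict_plane v w ` M)"
    by (rule type_ideal_image[OF type_ring_hom_restrict_plane surj MI])
  have one: "1 \<notin> restrict_plane v w ` M"
    using mem[of 1] M by (simp add: hom_one type_maximalideal_def)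
  have max: "\<exists>G. F * G - 1 \<in> restrict_plane v w ` M" if F: "F \<notin> restrict_plane v w ` M" for F
  proof -
    obtain f where f: "F = restrict_plane v w f" using surj by (meson surjD)
    then obtain g where "f * g - 1 \<in> M" using F mem[of f] M by (auto simp: type_maximalideal_def)
    then have "restrict_plane v w (f * g - 1) \<in> restrict_plane v w ` M" by simp
    then show ?thesis unfolding f by (auto simp: hom_diff hom_mult hom_one)
  qed
  then have "type_maximalideal (restrict_plane v w ` M)"
    using m one by (simp add: type_maximalideal_def)
  then have prime: "type_primeideal (restrict_plane v w ` M)" by (rule type_maximalideal_prime)
  obtain p where p: "p \<noteq> 0" "[:p:] \<in> restrict_plane v w ` M"
    using maximal_ideal_poly_poly_contains_constant[OF m one max] by blast
  have "\<exists>r. prime_elem r \<and> [:r:] \<in> restrict_plane v w ` M"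
    by (rule prime_ideal_contains_prime_constant[OF m one _ p])
      (use prime in \<open>auto simp: type_primeideal_def\<close>)
  then obtain r where r: "prime_elem r" "[:r:] \<in> restrict_plane v w ` M" by blast
  have "f \<in> M" if "\<And>c d. mpoly_eval (case_sum (\<lambda>i. c * v i) (\<lambda>j. d * w j)) f = poly r c" for f
  proof -
    have "restrict_plane v w f - [:r:] = 0"
      by (rule poly_poly_eq_0I) (simp add: poly_restrict_plane that)
    then show ?thesis using r(2) mem[of f] by simp
  qed
  then show ?thesis using r(1) by blast
qed

section \<open>Exchange of the two groups of variables\<close>

definition swap_xy :: "('m::finite + 'n::finite, 'k::comm_ring_1) mpoly \<Rightarrow> ('n + 'm, 'k) mpoly" where
  "swap_xy = mpoly_hom mpoly_const (case_sum (\<lambda>i. mpoly_var (Inr i)) (\<lambda>j. mpoly_var (Inl j)))"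

lemma type_ring_hom_swap_xy: "type_ring_hom swap_xy"
  unfolding swap_xy_def by (rule type_ring_hom.type_ring_hom_mpoly_hom[OF type_ring_hom_const])

lemma swap_xy_simps [simp]:
  "swap_xy (mpoly_const a) = mpoly_const a"
  "swap_xy (mpoly_var (Inl i)) = mpoly_var (Inr i)" "swap_xy (mpoly_var (Inr j)) = mpoly_var (Inl j)"
  unfolding swap_xy_def
  by (simp_all add: type_ring_hom.mpoly_hom_const[OF type_ring_hom_const]
      type_ring_hom.mpoly_hom_var[OF type_ring_hom_const])

lemma swap_xy_swap_xy [simp]: "swap_xy (swap_xy f) = f"
proof (rule mpoly_hom_unique[of "\<lambda>f. swap_xy (swap_xy f)" "\<lambda>f. f"])
  show "swap_xy (swap_xy (mpoly_var i)) = mpoly_var i" for i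
    by (cases i) simp_all
qed (simp_all add: type_ring_hom_comp[OF type_ring_hom_swap_xy type_ring_hom_swap_xy] type_ring_hom_id)

lemma mpoly_eval_swap_xy: "mpoly_eval (case_sum w v) (swap_xy f) = mpoly_eval (case_sum v w) f"
proof (rule mpoly_hom_unique[of "\<lambda>f. mpoly_eval (case_sum w v) (swap_xy f)"])
  show "mpoly_eval (case_sum w v) (swap_xy (mpoly_var i)) = mpoly_eval (case_sum v w) (mpoly_var i)" for i
    by (cases i) simp_all
qed (simp_all add: type_ring_hom_comp[OF type_ring_hom_mpoly_eval type_ring_hom_swap_xy] type_ring_hom_mpoly_eval)

text \<open>The iterated ring \<open>k[s][t]\<close> treats \<open>s\<close> and \<open>t\<close>
  differently; exchanging the groups of variables derives this case from the one for
  \<open>s\<close>.\<close>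

lemma maximal_ideal_over_plane_y:
  fixes v :: "'m::finite \<Rightarrow> 'k::field_char_0" and w :: "'n::finite \<Rightarrow> 'k"
  assumes M: "type_maximalideal M" and vw: "v \<noteq> (\<lambda>_. 0)" "w \<noteq> (\<lambda>_. 0)"
    and ker: "{f. restrict_plane v w f = 0} \<subseteq> M"
  shows "\<exists>r. prime_elem r \<and>
    (\<forall>f. (\<forall>c d. mpoly_eval (case_sum (\<lambda>i. c * v i) (\<lambda>j. d * w j)) f = poly r d) \<longrightarrow> f \<in> M)"
proof -
  interpret type_ring_hom "swap_xy :: ('n + 'm, 'k) mpoly \<Rightarrow> _" by (rule type_ring_hom_swap_xy)
  have "type_maximalideal {f. swap_xy f \<in> M}"
    unfolding type_maximalideal_def
  proof (intro conjI allI impI)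
    show "type_ideal {f. swap_xy f \<in> M}"
      using M by (auto simp: type_maximalideal_def type_ideal_def hom_zero hom_add hom_mult)
    show "1 \<notin> {f. swap_xy f \<in> M}" using M by (simp add: type_maximalideal_def hom_one)
    fix f assume "f \<notin> {f. swap_xy f \<in> M}"
    then obtain g where "swap_xy f * g - 1 \<in> M" using M by (auto simp: type_maximalideal_def)
    then show "\<exists>g. f * g - 1 \<in> {f. swap_xy f \<in> M}"
      by (intro exI[of _ "swap_xy g"]) (simp add: hom_diff hom_mult hom_one)
  qed
  moreover have "{f. restrict_plane w v f = 0} \<subseteq> {f. swap_xy f \<in> M}"
  proof clarify
    fix f assume f: "restrict_plane w v f = 0"
    have "restrict_plane v w (swap_xy f) = 0"
    proof (rule poly_poly_eq_0I)
      fix c d :: 'k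
      show "poly (poly (restrict_plane v w (swap_xy f)) [:d:]) c = 0"
        using poly_restrict_plane[of w v f c d] f by (simp add: poly_restrict_plane mpoly_eval_swap_xy)
    qed
    then show "swap_xy f \<in> M" using ker by blast
  qed
  ultimately obtain r where r: "prime_elem r"
    "\<And>f. (\<forall>c d. mpoly_eval (case_sum (\<lambda>i. c * w i) (\<lambda>j. d * v j)) f = poly r c) \<Longrightarrow> swap_xy f \<in> M"
    using maximal_ideal_over_plane_x[of "{f. swap_xy f \<in> M}" w v] vw by auto
  have "f \<in> M" if "\<forall>c d. mpoly_eval (case_sum (\<lambda>i. c * v i) (\<lambda>j. d * w j)) f = poly r d" for f
    using r(2)[of "swap_xy f"] that by (simp add: mpoly_eval_swap_xy)
  then show ?thesis using r(1) by blast
qed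

section \<open>Maximal ideals containing the ideal of the points\<close>

definition proj_rep :: "('v \<Rightarrow> 'k) set \<Rightarrow> 'v \<Rightarrow> 'k" where
  "proj_rep P = (SOME v. v \<in> P)"

lemma proj_rep_in: "P \<in> proj_space \<Longrightarrow> proj_rep P \<in> P"
  unfolding proj_rep_def by (rule someI_ex[OF proj_space_nonempty])

lemma proj_rep_nonzero: "P \<in> proj_space \<Longrightarrow> proj_rep P \<noteq> (\<lambda>_. 0)"
  by (rule proj_space_eq(2)[OF _ proj_rep_in])

definition plane_restriction ::
  "('m::finite \<Rightarrow> 'k::field) set \<times> ('n::finite \<Rightarrow> 'k) set \<Rightarrow> ('m + 'n, 'k) mpoly \<Rightarrow> 'k poly poly" where
  "plane_restriction z = restrict_plane (proj_rep (fst z)) (proj_rep (snd z))"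

lemma type_ring_hom_plane_restriction: "type_ring_hom (plane_restriction z)"
  unfolding plane_restriction_def by (rule type_ring_hom_restrict_plane)

lemma plane_restriction_const [simp]: "plane_restriction z (mpoly_const a) = [:[:a:]:]"
  by (simp add: plane_restriction_def)

lemma surj_plane_restriction: "z \<in> proj_space \<times> proj_space \<Longrightarrow> surj (plane_restriction z)"
  unfolding plane_restriction_def by (intro surj_restrict_plane proj_rep_nonzero) auto

lemma vanishing_ideal_iff:
  fixes Z :: "(('m::finite \<Rightarrow> 'k::field_char_0) set \<times> ('n::finite \<Rightarrow> 'k) set) set"
  assumes "Z \<subseteq> proj_space \<times> proj_space"
  shows "f \<in> vanishing_ideal Z \<longleftrightarrow> (\<forall>z\<in>Z. plane_restriction z f = 0)"
proof -
  have "(\<forall>v\<in>P. \<forall>w\<in>Q. mpoly_eval (case_sum v w) f = 0) \<longleftrightarrow> plane_restriction (P, Q) f = 0"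
    if "(P, Q) \<in> Z" for P Q
    using that assms unfolding plane_restriction_def fst_conv snd_conv
    by (intro vanishes_on_plane_iff proj_rep_in) auto
  then show ?thesis unfolding vanishing_ideal_def by auto
qed

text \<open>The first conclusion bounds the depth from below by 2, the second the codimension. Here
  \<open>K\<close> and \<open>L\<close> are the preimages of \<open>0\<close> and of
  \<open>(r)\<close> under restriction to one plane.\<close>

lemma maximal_ideal_over_vanishing_ideal:
  fixes Z :: "(('m::finite \<Rightarrow> 'k::field_char_0) set \<times> ('n::finite \<Rightarrow> 'k) set) set"
  assumes Z: "Z \<subseteq> proj_space \<times> proj_space" "finite Z"
    and chain: "\<And>P P'. Z `` {P} \<subseteq> Z `` {P'} \<or> Z `` {P'} \<subseteq> Z `` {P}"
    and M: "type_maximalideal M" "vanishing_ideal Z \<subseteq> M"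
  shows "\<exists>a\<in>M. \<exists>b\<in>M.
      (\<forall>g. a * g \<in> vanishing_ideal Z \<longrightarrow> g \<in> vanishing_ideal Z) \<and>
      (\<forall>g. b * g \<in> ideal_adjoin (vanishing_ideal Z) a \<longrightarrow> g \<in> ideal_adjoin (vanishing_ideal Z) a)"
    and "\<exists>K L. type_primeideal K \<and> type_primeideal L \<and> vanishing_ideal Z \<subseteq> K \<and> K \<subset> L \<and> L \<subset> M"
proof -
  have MI: "type_ideal M" using M by (simp add: type_maximalideal_def)
  \<comment> \<open>Otherwise each plane has a polynomial that vanishes on it and lies outside
    \<open>M\<close>; their product vanishes on all planes, hence lies in the prime ideal
    \<open>M\<close>.\<close>
  have "\<exists>z\<in>Z. {f. plane_restriction z f = 0} \<subseteq> M"
  proof (rule ccontr)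
    assume "\<not> ?thesis"
    then have "\<forall>z\<in>Z. \<exists>f. plane_restriction z f = 0 \<and> f \<notin> M" by blast
    then obtain F where F: "\<And>z. z \<in> Z \<Longrightarrow> plane_restriction z (F z) = 0 \<and> F z \<notin> M" by metis
    have "prod F Z \<in> vanishing_ideal Z"
      unfolding vanishing_ideal_iff[OF Z(1)] using Z(2) F by (auto simp: type_ring_hom.hom_prod[OF type_ring_hom_plane_restriction] intro: prod_zero)
    then have "\<exists>z\<in>Z. F z \<in> M"
      using type_primeideal_prod[OF type_maximalideal_prime[OF M(1)] Z(2)] M(2) by blast
    then show False using F by blast
  qed
  then obtain P Q where PQ: "(P, Q) \<in> Z" "{f. plane_restriction (P, Q) f = 0} \<subseteq> M" by force
  define v where "v = proj_rep P"
  define w where "w = proj_rep Q"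
  have P: "P \<in> proj_space" "Q \<in> proj_space" using PQ Z by auto
  have vw: "v \<noteq> (\<lambda>_. 0)" "w \<noteq> (\<lambda>_. 0)"
    using proj_rep_nonzero[OF P(1)] proj_rep_nonzero[OF P(2)] by (auto simp: v_def w_def)
  have ker: "{f. restrict_plane v w f = 0} \<subseteq> M" using PQ(2) by (simp add: plane_restriction_def v_def w_def)
  obtain r where r: "prime_elem r"
    "\<And>f. (\<forall>c d. mpoly_eval (case_sum (\<lambda>i. c * v i) (\<lambda>j. d * w j)) f = poly r c) \<Longrightarrow> f \<in> M"
    using maximal_ideal_over_plane_x[OF M(1) vw ker] by blast
  obtain s where s: "prime_elem s"
    "\<And>f. (\<forall>c d. mpoly_eval (case_sum (\<lambda>i. c * v i) (\<lambda>j. d * w j)) f = poly s d) \<Longrightarrow> f \<in> M"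
    using maximal_ideal_over_plane_y[OF M(1) vw ker] by blast
  have nz: "r \<noteq> 0" "s \<noteq> 0" using r(1) s(1) by auto
  have x_lines: "proj_rep P' \<noteq> (\<lambda>_. 0)" if "(P', Q') \<in> Z" for P' Q'
    using that Z by (intro proj_rep_nonzero) auto
  have y_lines: "proj_rep Q' \<noteq> (\<lambda>_. 0)" if "(P', Q') \<in> Z" for P' Q'
    using that Z by (intro proj_rep_nonzero) auto
  have "\<exists>p. (\<forall>c. mpoly_eval (\<lambda>i. c * v i) p = poly r c) \<and>
      (\<forall>u\<in>(proj_rep \<circ> fst) ` Z. finite {c. mpoly_eval (\<lambda>i. c * u i) p = 0})"
    using PQ(1) Z x_lines by (intro univariate_on_lines nz) (force simp: v_def)+
  then obtain p where p: "\<And>c. mpoly_eval (\<lambda>i. c * v i) p = poly r c"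
      "\<And>P Q. (P, Q) \<in> Z \<Longrightarrow> finite {c. mpoly_eval (\<lambda>i. c * proj_rep P i) p = 0}" by force
  have "\<exists>q. (\<forall>c. mpoly_eval (\<lambda>i. c * w i) q = poly s c) \<and>
      (\<forall>u\<in>(proj_rep \<circ> snd) ` Z. finite {c. mpoly_eval (\<lambda>i. c * u i) q = 0})"
    using PQ(1) Z y_lines by (intro univariate_on_lines nz) (force simp: w_def)+
  then obtain q where q: "\<And>c. mpoly_eval (\<lambda>i. c * w i) q = poly s c"
      "\<And>P Q. (P, Q) \<in> Z \<Longrightarrow> finite {c. mpoly_eval (\<lambda>i. c * proj_rep Q i) q = 0}" by force
  have pM: "embed_x p \<in> M" by (rule r(2)) (simp add: p)
  have qM: "embed_y q \<in> M" by (rule s(2)) (simp add: q)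
  show "\<exists>a\<in>M. \<exists>b\<in>M.
      (\<forall>g. a * g \<in> vanishing_ideal Z \<longrightarrow> g \<in> vanishing_ideal Z) \<and>
      (\<forall>g. b * g \<in> ideal_adjoin (vanishing_ideal Z) a \<longrightarrow> g \<in> ideal_adjoin (vanishing_ideal Z) a)"
  proof (rule bexI[OF _ pM], rule bexI[OF _ qM], intro conjI allI impI)
    fix g assume g: "embed_x p * g \<in> vanishing_ideal Z"
    show "g \<in> vanishing_ideal Z"
      unfolding vanishing_ideal_def
    proof (intro CollectI ballI, clarify)
      fix P Q v w assume *: "(P, Q) \<in> Z" "v \<in> P" "w \<in> Q"
      have P: "P \<in> proj_space" using * Z by auto
      obtain d where d: "v = (\<lambda>i. d * proj_rep P i)"
        using proj_space_eq(1)[OF P proj_rep_in[OF P]] *(2) by auto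
      have split: "case_sum (\<lambda>i. c * proj_rep P i) w = (\<lambda>i. case_sum (\<lambda>_. 0) w i + c * case_sum (proj_rep P) (\<lambda>_. 0) i)" for c
        by (auto simp: fun_eq_iff split: sum.split)
      have "mpoly_eval (\<lambda>i. case_sum (\<lambda>_. 0) w i + d * case_sum (proj_rep P) (\<lambda>_. 0) i) g = 0"
      proof (rule mpoly_eval_affine_line)
        \<comment> \<open>Besides the zeros of \<open>p\<close>, the parameter 0 is excluded because
          the zero vector does not belong to \<open>P\<close>.\<close>
        show "finite (insert 0 {c. mpoly_eval (\<lambda>i. c * proj_rep P i) p = 0})" using p(2)[OF *(1)] by simp
        fix c assume c: "c \<notin> insert 0 {c. mpoly_eval (\<lambda>i. c * proj_rep P i) p = 0}"
        then have "mpoly_eval (case_sum (\<lambda>i. c * proj_rep P i) w) (embed_x p * g) = 0"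
          using proj_space_scale[OF P proj_rep_in[OF P]] g * by (auto simp: vanishing_ideal_def)
        then have "mpoly_eval (case_sum (\<lambda>i. c * proj_rep P i) w) g = 0"
          using c by (simp add: type_ring_hom.hom_mult[OF type_ring_hom_mpoly_eval])
        then show "mpoly_eval (\<lambda>i. case_sum (\<lambda>_. 0) w i + c * case_sum (proj_rep P) (\<lambda>_. 0) i) g = 0"
          by (simp only: split)
      qed
      then show "mpoly_eval (case_sum v w) g = 0" by (simp only: d split)
    qed
  next
    fix g assume g: "embed_y q * g \<in> ideal_adjoin (vanishing_ideal Z) (embed_x p)"
    have "\<forall>w\<in>Q. mpoly_eval w h = 0"
      if PQ: "(P, Q) \<in> Z" and qh: "\<forall>w\<in>Q. mpoly_eval w (q * h) = 0" for P Q h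
    proof
      fix w assume w: "w \<in> Q"
      have Q: "Q \<in> proj_space" using PQ Z by auto
      obtain d where d: "w = (\<lambda>j. d * proj_rep Q j)" 
        using proj_space_eq(1)[OF Q proj_rep_in[OF Q]] w by auto
      have "mpoly_eval (\<lambda>j. 0 + d * proj_rep Q j) h = 0"
      proof (rule mpoly_eval_affine_line)
        show "finite (insert 0 {c. mpoly_eval (\<lambda>i. c * proj_rep Q i) q = 0})" using q(2)[OF PQ] by simp
        fix c assume c: "c \<notin> insert 0 {c. mpoly_eval (\<lambda>i. c * proj_rep Q i) q = 0}"
        then have "mpoly_eval (\<lambda>i. c * proj_rep Q i) (q * h) = 0"
          using proj_space_scale[OF Q proj_rep_in[OF Q]] qh by auto
        then show "mpoly_eval (\<lambda>j. 0 + c * proj_rep Q j) h = 0"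
          using c by (simp add: type_ring_hom.hom_mult[OF type_ring_hom_mpoly_eval])
      qed
      then show "mpoly_eval w h = 0" by (simp add: d)
    qed
    then show "g \<in> ideal_adjoin (vanishing_ideal Z) (embed_x p)"
      by (rule regular_modulo_of_chain[OF Z(2) chain _ g])
  qed
  interpret res: type_ring_hom "restrict_plane v w" by (rule type_ring_hom_restrict_plane)
  have surj: "surj (restrict_plane v w)" by (rule surj_restrict_plane[OF vw])
  define K where "K = {f. restrict_plane v w f = 0}"
  define L where "L = {f. [:r:] dvd restrict_plane v w f}"
  have rr: "prime_elem [:r:]" using r(1) by (simp add: prime_elem_const_poly_iff)
  have "type_primeideal K"
    unfolding type_primeideal_def type_ideal_def K_def by (auto simp: res.hom_zero res.hom_add res.hom_mult res.hom_one)
  moreover have "type_primeideal L"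
    unfolding type_primeideal_def type_ideal_def L_def using rr
    by (auto simp: res.hom_zero res.hom_add res.hom_mult res.hom_one prime_elem_dvd_mult_iff dest: prime_elem_not_unit)
  moreover have "vanishing_ideal Z \<subseteq> K"
    using vanishing_ideal_iff[OF Z(1)] PQ(1) by (force simp: K_def plane_restriction_def v_def w_def)
  moreover have "K \<subset> L"
  proof -
    obtain f where "restrict_plane v w f = [:r:]" using surj by (metis surjD)
    then have "f \<in> L" "f \<notin> K" using nz by (auto simp: K_def L_def)
    moreover have "K \<subseteq> L" by (auto simp: K_def L_def)
    ultimately show ?thesis by blast
  qed
  moreover have "L \<subset> M"
  proof -
    have restrict_p: "restrict_plane v w (embed_x p) = [:r:]"
    proof -
      have "restrict_plane v w (embed_x p) - [:r:] = 0"
        by (rule poly_poly_eq_0I) (simp add: poly_restrict_plane p)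
      then show ?thesis by simp
    qed
    have "f \<in> M" if "f \<in> L" for f
    proof -
      have "[:r:] dvd restrict_plane v w f" using that by (simp only: L_def mem_Collect_eq)
      then obtain G where "restrict_plane v w f = [:r:] * G" by (elim dvdE)
      moreover obtain g where "G = restrict_plane v w g" using surj by (meson surjD)
      ultimately have "restrict_plane v w (f - embed_x p * g) = 0"
        by (simp add: res.hom_diff res.hom_mult restrict_p)
      then have "f - embed_x p * g \<in> M" using ker by blast
      then show ?thesis
        using type_ideal_diff_cong[OF MI] type_ideal_mult_right[OF MI pM] by blast
    qed
    moreover have "embed_y q \<notin> L"
    proof
      assume "embed_y q \<in> L"
      then have "[:r:] dvd restrict_plane v w (embed_y q)" by (simp only: L_def mem_Collect_eq)
      then obtain G where G: "restrict_plane v w (embed_y q) = [:r:] * G" by (elim dvdE)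
      \<comment> \<open>Setting the outer variable equal to a non-root \<open>d\<close> of
        \<open>s\<close> makes \<open>r\<close> divide a nonzero constant.\<close>
      obtain d where d: "poly s d \<noteq> 0"
        using poly_roots_finite[OF nz(2)] ex_new_if_finite[OF infinite_UNIV_char_0] by blast
      have "poly (r * poly G [:d:]) c = poly [:poly s d:] c" for c
        using poly_restrict_plane[of v w "embed_y q" d c] by (simp add: G q)
      then have "r * poly G [:d:] = [:poly s d:]" by (intro poly_eq_poly_eq_iff[THEN iffD1]) auto
      then have "r dvd [:poly s d:]" by (metis dvd_triv_left)
      moreover have "[:poly s d:] dvd 1" using d by (simp add: is_unit_const_poly_iff dvd_field_iff)
      ultimately show False using r(1) by (meson dvd_trans prime_elem_not_unit)
    qed
    ultimately show ?thesis using qM by blast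
  qed
  ultimately show "\<exists>K L. type_primeideal K \<and> type_primeideal L \<and> vanishing_ideal Z \<subseteq> K \<and> K \<subset> L \<and> L \<subset> M"
    by blast
qed

section \<open>Quotients of type-class rings\<close>

locale type_quotient =
  fixes I :: "'a::comm_ring_1 set"
  assumes I: "type_ideal I"
begin

abbreviation quot_ring :: "'a set ring" where
  "quot_ring \<equiv> (ring_of_type_algebra :: 'a ring) Quot I"

definition proj :: "'a \<Rightarrow> 'a set" where
  "proj f = I +>\<^bsub>ring_of_type_algebra\<^esub> f"

text \<open>Including \<open>I\<close> makes this the full preimage of the ideal that the classes of
  \<open>S\<close> generate in the quotient.\<close>

definition ideal_gen :: "'a set \<Rightarrow> 'a set" where
  "ideal_gen S = {f. \<forall>K. type_ideal K \<longrightarrow> I \<subseteq> K \<longrightarrow> S \<subseteq> K \<longrightarrow> f \<in> K}"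

sublocale R: cring "ring_of_type_algebra :: 'a ring"
  by (rule cring_from_type_algebra)

sublocale R: ideal I "ring_of_type_algebra :: 'a ring"
  using I by (simp add: ideal_ring_of_type_algebra_iff)

sublocale Q: cring quot_ring
  by (rule R.quotient_is_cring[OF cring_from_type_algebra])

lemma carrier_R [simp]: "carrier (ring_of_type_algebra :: 'a ring) = UNIV"
  by (simp add: ring_of_type_algebra_def)

lemma proj_hom: "proj \<in> ring_hom ring_of_type_algebra quot_ring"
  unfolding proj_def using R.rcos_ring_hom by (simp add: ring_hom_def)

lemma carrier_quot: "carrier quot_ring = range proj"
  by (auto simp: FactRing_def A_RCOSETS_def' proj_def)

lemma proj_closed [simp]: "proj f \<in> carrier quot_ring"
  by (simp add: carrier_quot)

lemma proj_eq_iff: "proj f = proj g \<longleftrightarrow> f - g \<in> I"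
proof -
  have "\<ominus>\<^bsub>ring_of_type_algebra\<^esub> g = - g"
    by (rule R.minus_equality) (auto simp: ring_of_type_algebra_def)
  then have "f \<ominus>\<^bsub>ring_of_type_algebra\<^esub> g = f - g"
    by (simp add: a_minus_def ring_of_type_algebra_def)
  then show ?thesis
    using R.quotient_eq_iff_same_a_r_cos[OF R.is_ideal, of f g] by (simp add: proj_def)
qed

lemma proj_simps:
  "proj f \<otimes>\<^bsub>quot_ring\<^esub> proj g = proj (f * g)" "\<one>\<^bsub>quot_ring\<^esub> = proj 1"
  using ring_hom_mult[OF proj_hom, of f g] ring_hom_one[OF proj_hom]
  by (simp_all add: ring_of_type_algebra_def)

lemma vimage_ideal:
  assumes "ideal J quot_ring"
  shows "type_ideal {f. proj f \<in> J}" "I \<subseteq> {f. proj f \<in> J}" "J = proj ` {f. proj f \<in> J}"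
proof -
  interpret J: ideal J quot_ring by fact
  have "ring_hom_ring ring_of_type_algebra quot_ring proj"
    unfolding proj_def using R.rcos_ring_hom_ring by simp
  then interpret ring_hom_ring "ring_of_type_algebra :: 'a ring" quot_ring proj .
  show K: "type_ideal {f. proj f \<in> J}"
    using ideal_vimage[OF assms] by (simp add: ideal_ring_of_type_algebra_iff)
  show "I \<subseteq> {f. proj f \<in> J}"
  proof
    fix f assume "f \<in> I"
    then have "proj f = proj 0" by (simp add: proj_eq_iff)
    then show "f \<in> {f. proj f \<in> J}" using type_ideal_zero[OF K] by simp
  qed
  show "J = proj ` {f. proj f \<in> J}"
    using J.a_subset carrier_quot by auto
qed

lemma proj_mem_image_iff:
  assumes "type_ideal K" "I \<subseteq> K"
  shows "proj f \<in> proj ` K \<longleftrightarrow> f \<in> K"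
  using type_ideal_diff_cong[OF assms(1), of f] assms(2) by (auto simp: proj_eq_iff)

lemma image_ideal: "type_ideal K \<Longrightarrow> ideal (proj ` K) quot_ring"
  using R.ring_ideal_imp_quot_ideal[OF R.is_ideal, of K]
  by (simp add: ideal_ring_of_type_algebra_iff proj_def[abs_def])

lemma vimage_primeideal:
  assumes "primeideal J quot_ring"
  shows "type_primeideal {f. proj f \<in> J}"
proof -
  interpret J: primeideal J quot_ring by fact
  have "proj 1 \<notin> J"
    using J.one_imp_carrier J.I_notcarr proj_simps(2) by auto
  moreover have "proj f \<in> J \<or> proj g \<in> J" if "proj (f * g) \<in> J" for f g
    using J.I_prime[of "proj f" "proj g"] that by (simp add: proj_simps)
  ultimately show ?thesis
    using vimage_ideal(1)[OF J.is_ideal] by (auto simp: type_primeideal_def)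
qed

lemma image_primeideal:
  assumes "type_primeideal K" "I \<subseteq> K"
  shows "primeideal (proj ` K) quot_ring"
proof -
  have K: "type_ideal K" using assms by (simp add: type_primeideal_def)
  show ?thesis
  proof (rule primeidealI)
    show "ideal (proj ` K) quot_ring" by (rule image_ideal[OF K])
    show "cring quot_ring" by (rule Q.cring_axioms)
    have "proj 1 \<notin> proj ` K"
      using assms(1) proj_mem_image_iff[OF K assms(2)] by (simp add: type_primeideal_def)
    then show "carrier quot_ring \<noteq> proj ` K" using proj_closed[of 1] by blast
  next
    fix a b
    assume "a \<in> carrier quot_ring" "b \<in> carrier quot_ring" and ab: "a \<otimes>\<^bsub>quot_ring\<^esub> b \<in> proj ` K"
    then obtain f g where fg: "a = proj f" "b = proj g" by (auto simp: carrier_quot)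
    have "f * g \<in> K" using ab proj_mem_image_iff[OF K assms(2)] by (simp add: fg proj_simps)
    then show "a \<in> proj ` K \<or> b \<in> proj ` K"
      using assms(1) by (auto simp: fg type_primeideal_def)
  qed
qed

lemma vimage_maximalideal:
  assumes "maximalideal J quot_ring"
  shows "type_maximalideal {f. proj f \<in> J}"
proof -
  interpret J: maximalideal J quot_ring by fact
  define K where "K = {f. proj f \<in> J}"
  have K: "type_ideal K" "I \<subseteq> K" "J = proj ` K"
    using vimage_ideal[OF J.is_ideal] by (simp_all add: K_def)
  have "1 \<notin> K"
    using J.one_imp_carrier J.I_notcarr proj_simps(2) by (auto simp: K_def)
  moreover have "\<exists>g. f * g - 1 \<in> K" if f: "f \<notin> K" for f
  proof -
    define L where "L = ideal_adjoin K f"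
    have L: "type_ideal L" "K \<subseteq> L"
      unfolding L_def by (auto intro: type_ideal_ideal_adjoin[OF K(1)] subsetD[OF subset_ideal_adjoin])
    have "f \<in> L" using mult_in_ideal_adjoin[OF K(1), of f 1] by (simp add: L_def)
    then have "proj ` L \<noteq> J" using f by (auto simp: K_def)
    then have "proj ` L = carrier quot_ring"
      using J.I_maximal[OF image_ideal[OF L(1)]] L(2) K(3) by (auto simp: carrier_quot)
    then have "proj 1 \<in> proj ` L" using proj_closed[of 1] by simp
    then have "1 \<in> L" using proj_mem_image_iff[OF L(1), of 1] L(2) K(2) by auto
    then obtain r i where ri: "1 = f * r + i" "i \<in> K" by (auto simp: L_def ideal_adjoin_def)
    have "f * r - 1 = f * r - (f * r + i)" by (simp only: ri(1)[symmetric])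
    then have "f * r - 1 \<in> K" using type_ideal_uminus[OF K(1) ri(2)] by simp
    then show ?thesis ..
  qed
  ultimately show ?thesis using K(1) by (auto simp: type_maximalideal_def K_def)
qed

section \<open>Generated ideals and regular sequences in the quotient\<close>

lemma type_ideal_ideal_gen: "type_ideal (ideal_gen S)"
  unfolding type_ideal_def[of "ideal_gen S"]
  by (auto simp: ideal_gen_def intro: type_ideal_zero type_ideal_add type_ideal_mult_left)

lemma ideal_gen_superset: "I \<subseteq> ideal_gen S" "S \<subseteq> ideal_gen S"
  by (auto simp: ideal_gen_def)

lemma ideal_gen_minimal: "type_ideal K \<Longrightarrow> I \<subseteq> K \<Longrightarrow> S \<subseteq> K \<Longrightarrow> ideal_gen S \<subseteq> K"
  by (auto simp: ideal_gen_def)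

lemma ideal_gen_mono: "S \<subseteq> T \<Longrightarrow> ideal_gen S \<subseteq> ideal_gen T"
  using ideal_gen_superset[of T] by (intro ideal_gen_minimal type_ideal_ideal_gen) auto

lemma ideal_gen_empty: "ideal_gen {} = I"
  using ideal_gen_minimal[OF I, of "{}"] ideal_gen_superset(1)[of "{}"] by auto

lemma ideal_gen_singleton: "ideal_gen {a} = ideal_adjoin I a"
proof
  show "ideal_gen {a} \<subseteq> ideal_adjoin I a"
    using mult_in_ideal_adjoin[OF I, of a 1]
    by (intro ideal_gen_minimal type_ideal_ideal_adjoin I subset_ideal_adjoin) auto
  show "ideal_adjoin I a \<subseteq> ideal_gen {a}"
    using ideal_gen_superset[of "{a}"] type_ideal_mult_right[OF type_ideal_ideal_gen, of a "{a}"]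
    by (auto simp: ideal_adjoin_def intro!: type_ideal_add[OF type_ideal_ideal_gen])
qed

lemma genideal_proj: "Idl\<^bsub>quot_ring\<^esub> (proj ` S) = proj ` ideal_gen S"
proof
  show "Idl\<^bsub>quot_ring\<^esub> (proj ` S) \<subseteq> proj ` ideal_gen S"
    by (intro Q.genideal_minimal image_ideal type_ideal_ideal_gen image_mono ideal_gen_superset)
  have *: "ideal (Idl\<^bsub>quot_ring\<^esub> (proj ` S)) quot_ring"
    by (rule Q.genideal_ideal) auto
  have "ideal_gen S \<subseteq> {f. proj f \<in> Idl\<^bsub>quot_ring\<^esub> (proj ` S)}"
  proof (intro ideal_gen_minimal vimage_ideal[OF *] subsetI CollectI)
    show "proj f \<in> Idl\<^bsub>quot_ring\<^esub> (proj ` S)" if "f \<in> S" for f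
      by (rule subsetD[OF Q.genideal_self]) (use that in auto)
  qed
  then show "proj ` ideal_gen S \<subseteq> Idl\<^bsub>quot_ring\<^esub> (proj ` S)" by auto
qed

lemma proj_mem_genideal_iff: "proj f \<in> Idl\<^bsub>quot_ring\<^esub> (proj ` S) \<longleftrightarrow> f \<in> ideal_gen S"
  unfolding genideal_proj by (rule proj_mem_image_iff[OF type_ideal_ideal_gen ideal_gen_superset(1)])

lemma noetherian_quot:
  assumes "\<And>J. type_ideal J \<Longrightarrow> I \<subseteq> J \<Longrightarrow>
    \<exists>G. finite G \<and> G \<subseteq> J \<and> (\<forall>K. type_ideal K \<longrightarrow> I \<subseteq> K \<longrightarrow> G \<subseteq> K \<longrightarrow> J \<subseteq> K)"
  shows "noetherian_ring quot_ring"
proof (rule Q.noetherian_ringI)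
  fix J assume "ideal J quot_ring"
  note J = vimage_ideal[OF this]
  obtain G where G: "finite G" "G \<subseteq> {f. proj f \<in> J}"
    "\<And>K. type_ideal K \<Longrightarrow> I \<subseteq> K \<Longrightarrow> G \<subseteq> K \<Longrightarrow> {f. proj f \<in> J} \<subseteq> K"
    using assms[OF J(1,2)] by blast
  have "{f. proj f \<in> J} = ideal_gen G"
    using G(3)[OF type_ideal_ideal_gen ideal_gen_superset] ideal_gen_minimal[OF J(1,2) G(2)] by auto
  then have "J = Idl\<^bsub>quot_ring\<^esub> (proj ` G)"
    using J(3) by (simp add: genideal_proj)
  then show "\<exists>A\<subseteq>carrier quot_ring. finite A \<and> J = Idl\<^bsub>quot_ring\<^esub> A"
    using G(1) by (intro exI[of _ "proj ` G"]) auto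
qed

lemma regular_sequence_proj:
  "regular_sequence quot_ring (map proj xs) \<longleftrightarrow>
     1 \<notin> ideal_gen (set xs) \<and>
     (\<forall>i<length xs. \<forall>g. xs ! i * g \<in> ideal_gen (set (take i xs)) \<longrightarrow> g \<in> ideal_gen (set (take i xs)))"
proof -
  have "Idl\<^bsub>quot_ring\<^esub> (proj ` set xs) = carrier quot_ring \<longleftrightarrow> 1 \<in> ideal_gen (set xs)"
  proof
    assume "Idl\<^bsub>quot_ring\<^esub> (proj ` set xs) = carrier quot_ring"
    then show "1 \<in> ideal_gen (set xs)" using proj_mem_genideal_iff[of 1 "set xs"] by simp
  next
    assume "1 \<in> ideal_gen (set xs)"
    then have "\<one>\<^bsub>quot_ring\<^esub> \<in> Idl\<^bsub>quot_ring\<^esub> (proj ` set xs)"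
      by (simp add: proj_mem_genideal_iff proj_simps)
    then show "Idl\<^bsub>quot_ring\<^esub> (proj ` set xs) = carrier quot_ring"
      by (rule ideal.one_imp_carrier[rotated]) (rule Q.genideal_ideal, auto)
  qed
  moreover have "set (map proj xs) \<subseteq> carrier quot_ring" by auto
  moreover have "(\<forall>y\<in>carrier quot_ring. map proj xs ! i \<otimes>\<^bsub>quot_ring\<^esub> y
        \<in> Idl\<^bsub>quot_ring\<^esub> (set (take i (map proj xs)))
        \<longrightarrow> y \<in> Idl\<^bsub>quot_ring\<^esub> (set (take i (map proj xs)))) \<longleftrightarrow>
      (\<forall>g. xs ! i * g \<in> ideal_gen (set (take i xs)) \<longrightarrow> g \<in> ideal_gen (set (take i xs)))"
    if "i < length xs" for i
    using that by (simp add: carrier_quot take_map proj_simps proj_mem_genideal_iff)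
  ultimately show ?thesis
    unfolding regular_sequence_def by simp
qed

end

section \<open>Depth and codimension\<close>

text \<open>Common source of both upper bounds: a nontrivial relation among \<open>x 0\<close>,
  \<open>x 1\<close>, \<open>x 2\<close> holds modulo the ideal of the points, so three regular
  steps reach the unit ideal.\<close>

lemma regular_chain_modulo_vanishing_ideal:
  fixes Z :: "(('m::finite \<Rightarrow> 'k::field_char_0) set \<times> ('n::finite \<Rightarrow> 'k) set) set"
  assumes Z: "Z \<subseteq> proj_space \<times> proj_space" "finite Z"
    and J: "\<And>i. i < 4 \<Longrightarrow> type_ideal (J i)" "\<And>i. i < 3 \<Longrightarrow> J i \<subseteq> J (Suc i)" "vanishing_ideal Z \<subseteq> J 0"
    and x: "\<And>i. i < 3 \<Longrightarrow> x i \<in> J (Suc i)" "\<And>i y. i < 3 \<Longrightarrow> x i * y \<in> J i \<Longrightarrow> y \<in> J i"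
  shows "1 \<in> J (3::nat)"
proof -
  let ?s = "\<lambda>N k. \<Sum>a<N. (\<Sum>b<N. (\<Sum>c<N. mpoly_const (k a b c) * x 2 ^ c) * x 1 ^ b) * x 0 ^ a"
  have "\<exists>N k. (\<exists>a<N. \<exists>b<N. \<exists>c<N. k a b c \<noteq> 0) \<and> (\<forall>z\<in>Z. plane_restriction z (?s N k) = 0)"
    by (rule algebraically_dependent_triple[OF Z(2) type_ring_hom_plane_restriction plane_restriction_const])
  then obtain N where "\<exists>k. (\<exists>a<N. \<exists>b<N. \<exists>c<N. k a b c \<noteq> 0) \<and> (\<forall>z\<in>Z. plane_restriction z (?s N k) = 0)" ..
  then obtain k where k: "(\<exists>a<N. \<exists>b<N. \<exists>c<N. k a b c \<noteq> 0) \<and> (\<forall>z\<in>Z. plane_restriction z (?s N k) = 0)" ..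
  have "?s N k \<in> vanishing_ideal Z"
    unfolding vanishing_ideal_iff[OF Z(1)] using k by (rule conjunct2)
  then have dep: "?s N k \<in> J 0" using J(3) by (rule subsetD[rotated])
  show ?thesis
    by (rule regular_chain_of_dependent[where J = J and x = x and k = k and N = N, OF type_ring_hom_const])
      (fact J(1) J(2) x(1) x(2) dep k[THEN conjunct1])+
qed

lemma Sup_enat_eqI:
  assumes "enat n \<in> A" "\<And>a. a \<in> A \<Longrightarrow> a \<le> enat n"
  shows "Sup A = enat n"
  using assms by (intro antisym Sup_least Sup_upper)

theorem corollary3p8:
  fixes Z :: "(('m::finite \<Rightarrow> 'k::field_char_0) set \<times> ('n::finite \<Rightarrow> 'k) set) set"
  assumes "Z \<subseteq> proj_space \<times> proj_space"
    and "finite Z"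
    and "inclusion_property Z"
  shows "biproj_ACM Z"
proof -
  have level: "snd ` (fst -` {P} \<inter> Z) = Z `` {P}" for P by force
  \<comment> \<open>Classes outside the projection have empty fibre, so comparability holds for all
    \<open>P\<close> and \<open>P'\<close> without membership conditions.\<close>
  have chain: "Z `` {P} \<subseteq> Z `` {P'} \<or> Z `` {P'} \<subseteq> Z `` {P}" for P P'
  proof (cases "P \<in> fst ` Z \<and> P' \<in> fst ` Z")
    case True
    then have "Z `` {P} \<in> (\<lambda>L. snd ` L) ` level_sets Z" "Z `` {P'} \<in> (\<lambda>L. snd ` L) ` level_sets Z"
      unfolding level_sets_def by (auto simp flip: level)
    then show ?thesis
      by (rule assms(3)[unfolded inclusion_property_def chain_subset_def, THEN conjunct1, rule_format])
  next
    case False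
    then have "Z `` {P} = {} \<or> Z `` {P'} = {}" by force
    then show ?thesis by auto
  qed
  define V where "V = vanishing_ideal Z"
  interpret type_quotient V
    by unfold_locales (simp add: V_def type_ideal_vanishing_ideal)
  have "noetherian_ring quot_ring"
  proof (rule noetherian_quot)
    fix J assume J: "type_ideal J" "V \<subseteq> J"
    \<comment> \<open>Two applications of the Hilbert basis theorem, starting from the
      field.\<close>
    have "type_ideal I \<Longrightarrow> finitely_generated I" for I :: "'k poly poly set"
      by (intro hilbert_basis finitely_generated_field)
    then have "\<exists>G. finite G \<and> G \<subseteq> J \<and> (\<forall>I. type_ideal I \<longrightarrow>
        {f \<in> J. \<forall>z\<in>Z. plane_restriction z f = 0} \<subseteq> I \<longrightarrow> G \<subseteq> I \<longrightarrow> J \<subseteq> I)"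
      using assms(1) J(1)
      by (intro finitely_generated_modulo_kernels[OF assms(2)] type_ring_hom_plane_restriction surj_plane_restriction) auto
    then obtain G where G: "finite G" "G \<subseteq> J"
      "\<And>I. type_ideal I \<Longrightarrow> {f \<in> J. \<forall>z\<in>Z. plane_restriction z f = 0} \<subseteq> I \<Longrightarrow> G \<subseteq> I \<Longrightarrow> J \<subseteq> I"
      by blast
    have "{f \<in> J. \<forall>z\<in>Z. plane_restriction z f = 0} \<subseteq> V"
      unfolding V_def using vanishing_ideal_iff[OF assms(1)] by blast
    then show "\<exists>G. finite G \<and> G \<subseteq> J \<and> (\<forall>K. type_ideal K \<longrightarrow> V \<subseteq> K \<longrightarrow> G \<subseteq> K \<longrightarrow> J \<subseteq> K)"
      using G by (intro exI[of _ G]) auto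
  qed
  moreover have "ideal_depth quot_ring P = prime_codim quot_ring P" if "maximalideal P quot_ring" for P
  proof -
    interpret P: maximalideal P quot_ring by fact
    define M where "M = {f. proj f \<in> P}"
    have M: "type_maximalideal M" "V \<subseteq> M" "P = proj ` M"
      unfolding M_def using vimage_maximalideal[OF that] vimage_ideal[OF P.is_ideal] by auto
    have MI: "type_ideal M" "1 \<notin> M" using M(1) by (auto simp: type_maximalideal_def)
    note over = maximal_ideal_over_vanishing_ideal[OF assms(1,2) chain M(1) M(2)[unfolded V_def], folded V_def]
    have "ideal_depth quot_ring P = enat 2"
      unfolding ideal_depth_def
    proof (rule Sup_enat_eqI)
      obtain a b where ab: "a \<in> M" "b \<in> M" "\<And>g. a * g \<in> V \<Longrightarrow> g \<in> V"
        "\<And>g. b * g \<in> ideal_adjoin V a \<Longrightarrow> g \<in> ideal_adjoin V a"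
        using over(1) by blast
      have "1 \<notin> ideal_gen (set [a, b])"
        using ideal_gen_minimal[OF MI(1) M(2), of "{a, b}"] ab MI(2) by auto
      then have "regular_sequence quot_ring (map proj [a, b])"
        unfolding regular_sequence_proj using ab(3,4)
        by (auto simp: less_Suc_eq ideal_gen_empty ideal_gen_singleton)
      moreover have "set (map proj [a, b]) \<subseteq> P" using ab M(3) by auto
      moreover have "length (map proj [a, b]) = 2" by simp
      ultimately show "enat 2 \<in> {enat (length xs) |xs. regular_sequence quot_ring xs \<and> set xs \<subseteq> P}"
        by (metis (mono_tags, lifting) mem_Collect_eq)
    next
      fix d assume "d \<in> {enat (length xs) |xs. regular_sequence quot_ring xs \<and> set xs \<subseteq> P}"
      then obtain xs where xs: "d = enat (length xs)" "regular_sequence quot_ring xs" by auto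
      then have "set xs \<subseteq> proj ` UNIV" by (simp add: regular_sequence_def carrier_quot)
      then obtain ys where ys: "xs = map proj ys" by (metis subset_image_iff ex_map_conv image_iff subsetD)
      have reg: "1 \<notin> ideal_gen (set ys)"
        "\<And>i g. i < length ys \<Longrightarrow> ys ! i * g \<in> ideal_gen (set (take i ys)) \<Longrightarrow> g \<in> ideal_gen (set (take i ys))"
        using xs(2) unfolding ys regular_sequence_proj by auto
      have "\<not> length ys \<ge> 3"
      proof
        assume len: "length ys \<ge> 3"
        \<comment> \<open>The first three elements of a longer sequence already generate the unit
          ideal, which a regular sequence must not do.\<close>
        have "1 \<in> ideal_gen (set (take 3 ys))"
        proof (rule regular_chain_modulo_vanishing_ideal[OF assms(1,2), of "\<lambda>i. ideal_gen (set (take i ys))" "(!) ys"])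
          show "ideal_gen (set (take i ys)) \<subseteq> ideal_gen (set (take (Suc i) ys))" for i
            by (rule ideal_gen_mono) (auto intro: set_take_subset_set_take[THEN subsetD, of i "Suc i"])
          show "ys ! i \<in> ideal_gen (set (take (Suc i) ys))" if "i < 3" for i
            using that len by (intro subsetD[OF ideal_gen_superset(2)]) (auto simp: take_Suc_conv_app_nth)
          show "g \<in> ideal_gen (set (take i ys))" if "i < 3" "ys ! i * g \<in> ideal_gen (set (take i ys))" for i g
            using reg(2)[of i g] that len by simp
          show "vanishing_ideal Z \<subseteq> ideal_gen (set (take 0 ys))"
            unfolding V_def[symmetric] by (rule ideal_gen_superset)
        qed (rule type_ideal_ideal_gen)
        moreover have "ideal_gen (set (take 3 ys)) \<subseteq> ideal_gen (set ys)"
          by (rule ideal_gen_mono) (rule set_take_subset)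
        ultimately show False using reg(1) by blast
      qed
      then show "d \<le> enat 2" using xs(1) ys by simp
    qed
    moreover have "prime_codim quot_ring P = enat 2"
      unfolding prime_codim_def
    proof (rule Sup_enat_eqI)
      obtain K L where KL: "type_primeideal K" "type_primeideal L" "V \<subseteq> K" "K \<subset> L" "L \<subset> M"
        using over(2) by blast
      have strict: "proj ` A \<subset> proj ` B" if AB: "A \<subset> B" and A: "type_ideal A" "V \<subseteq> A" for A B
      proof
        show "proj ` A \<subseteq> proj ` B" using AB by (intro image_mono) simp
        obtain f where "f \<in> B" "f \<notin> A" using AB by blast
        then show "proj ` A \<noteq> proj ` B" using proj_mem_image_iff[OF A, of f] by auto
      qed
      have sub: "V \<subseteq> L" using KL by blast
      have "proj ` K \<subset> proj ` L"
        by (rule strict) (use KL in \<open>simp_all add: type_primeideal_def\<close>)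
      moreover have "proj ` L \<subset> P"
        unfolding M(3) by (rule strict) (use KL sub in \<open>simp_all add: type_primeideal_def\<close>)
      moreover have "primeideal (proj ` K) quot_ring" "primeideal (proj ` L) quot_ring"
        by (intro image_primeideal KL sub)+
      moreover have "primeideal P quot_ring" by (rule Q.maximalideal_prime[OF that])
      ultimately have "sorted_wrt (\<subset>) [proj ` K, proj ` L, P] \<and>
          (\<forall>I \<in> set [proj ` K, proj ` L, P]. primeideal I quot_ring) \<and> last [proj ` K, proj ` L, P] = P"
        by auto
      \<comment> \<open>Codimension counts inclusions: three primes form a chain of length
        2.\<close>
      moreover have "length [proj ` K, proj ` L, P] = Suc 2" by simp
      ultimately show "enat 2 \<in> {enat n |n. \<exists>Ps. length Ps = Suc n \<and> sorted_wrt (\<subset>) Ps \<and>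
                         (\<forall>Q \<in> set Ps. primeideal Q quot_ring) \<and> last Ps = P}"
        by blast
    next
      fix d assume "d \<in> {enat n |n. \<exists>Ps. length Ps = Suc n \<and> sorted_wrt (\<subset>) Ps \<and>
                         (\<forall>Q \<in> set Ps. primeideal Q quot_ring) \<and> last Ps = P}"
      then obtain n Ps where n: "d = enat n" "length Ps = Suc n" "sorted_wrt (\<subset>) Ps"
        "\<And>Q. Q \<in> set Ps \<Longrightarrow> primeideal Q quot_ring" by blast
      have "\<not> n \<ge> 3"
      proof
        assume "n \<ge> 3"
        define J where "J = (\<lambda>i. {f. proj f \<in> Ps ! i})"
        have pr: "primeideal (Ps ! i) quot_ring" if "i < 4" for i
          using that \<open>n \<ge> 3\<close> n(2) by (intro n(4) nth_mem) simp
        have J: "type_primeideal (J i)" if "i < 4" for i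
          unfolding J_def by (rule vimage_primeideal[OF pr[OF that]])
        have JV: "V \<subseteq> J i" "Ps ! i = proj ` J i" if "i < 4" for i
          unfolding J_def using vimage_ideal[OF primeideal.axioms(1)[OF pr[OF that]]] by auto
        have strict: "J i \<subset> J (Suc i)" if "i < 3" for i
        proof -
          have "Ps ! i \<subset> Ps ! Suc i"
            using n(2,3) that \<open>n \<ge> 3\<close> by (simp add: sorted_wrt_iff_nth_less)
          moreover have "Ps ! i = proj ` J i" "Ps ! Suc i = proj ` J (Suc i)"
            using that by (intro JV(2); simp)+
          ultimately have "J i \<noteq> J (Suc i)" by auto
          moreover have "J i \<subseteq> J (Suc i)"
            using \<open>Ps ! i \<subset> Ps ! Suc i\<close> unfolding J_def by blast
          ultimately show ?thesis by blast
        qed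
        then have "\<forall>i. i < 3 \<longrightarrow> (\<exists>x. x \<in> J (Suc i) \<and> x \<notin> J i)" by blast
        then obtain x where x: "\<And>i. i < 3 \<Longrightarrow> x i \<in> J (Suc i) \<and> x i \<notin> J i" by metis
        have "1 \<in> J 3"
        proof (rule regular_chain_modulo_vanishing_ideal[OF assms(1,2), of J x])
          show "y \<in> J i" if "i < 3" "x i * y \<in> J i" for i y
            using J[of i] x[of i] that by (auto simp: type_primeideal_def)
          show "J i \<subseteq> J (Suc i)" if "i < 3" for i
            using strict[OF that] by blast
        qed (use J JV(1) x in \<open>auto simp: type_primeideal_def V_def\<close>)
        then show False using J[of 3] by (simp add: type_primeideal_def)
      qed
      then show "d \<le> enat 2" using n(1) by simp
    qed
    ultimately show ?thesis by simp
  qed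
  ultimately have "cohen_macaulay quot_ring"
    unfolding cohen_macaulay_def using Q.cring_axioms by blast
  then show ?thesis
    unfolding biproj_ACM_def biproj_ideal_eq_vanishing_ideal[OF assms(1)] V_def .
qed

end
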